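(* Let $\{V_n^{(k)}\}_{k=1}^K$, $n\ge 0$, be the ensemble of the ensemble Kalman filter with adaptive inflation (EnKF-AI) described in the context, run with any inflation strengths satisfying $\lambda_n\ge\varphi(\Theta_n,\Xi_n)$ for all $n\ge 1$. Let $\rho_0=\min_{1\le i\le q}h_i^2$ denote the minimum eigenvalue of $H_0H_0^T$. (i) For all $n\ge 1$ and $1\le k\le K$, almost surely $$|HV_n^{(k)}-Z_n^{(k)}|\le \sqrt{K}\,\max\{M_1,\ \rho_0^{-1}c_\varphi^{-1}\}.$$ (ii) Suppose additionally that the model satisfies an energy principle: there are constants $\beta_h\in(0,1)$, $K_h>0$ such that $$|\Psi_h(u)|^2+\mathrm{tr}(R_h(u))\le(1-\beta_h)|u|^2+K_h\quad\text{for all }u\in\mathbb{R}^d$$ (equivalently $\mathbb{E}(|U_n|^2\mid U_0,\dots,U_{n-1})\le(1-\beta_h)|U_{n-1}|^2+K_h$ a.s.). Let $$\mathcal{E}_n=4K\rho_0^{-1}\beta_h^{-1}\|H\|^2|U_n|^2+\sum_{k=1}^K|V_n^{(k)}|^2 .$$ Then there exists a constant $D>0$ such that for all $n\ge1$ $$\mathbb{E}_{n-1}\mathcal{E}_n\le(1-\tfrac12\beta_h)\,\mathcal{E}_{n-1}+D .$$ In particular, if $\mathbb{E}\,\mathcal{E}_0<\infty$, then $\sup_{n\ge0}\mathbb{E}\,\mathcal{E}_n<\infty$.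
   Context: **Signal.** $U_n\in\mathbb{R}^d$ is generated by $U_n=\Psi_h(U_{n-1})+\zeta_n$, where $\Psi_h:\mathbb{R}^d\to\mathbb{R}^d$ is a deterministic (measurable) map. Conditionally on $U_{n-1}$, the noise $\zeta_n$ is independent of the past, has a conditional law depending only on $U_{n-1}$, conditional mean $0$ and conditional covariance $R_h(U_{n-1})=\mathbb{E}(\zeta_n\otimes\zeta_n\mid U_{n-1})$. Thus $U_n$ is a Markov chain. **Observations.** $Z_n=HU_n+\xi_n\in\mathbb{R}^q$, where $1\le q\le d$, $H=(H_0,0_{q\times(d-q)})$, $H_0=\mathrm{diag}(h_1,\dots,h_q)$ with $h_i>0$ fixed, and $\xi_n\sim\mathcal N(0,I_q)$ are i.i.d. and independent of the signal noise and of the past. **EnKF-AI.** Fix the ensemble size $K\ge2$, and constants $c_\varphi>0$, $M_1>0$, $M_2>0$. Given the ensemble $\{V_{n-1}^{(k)}\}_{k=1}^K\subset\mathbb{R}^d$ at time $n-1$: - Forecast: $\widehat V_n^{(k)}=\Psi_h(V_{n-1}^{(k)})+\zeta_n^{(k)}$, where, conditionally on the past, the $\zeta_n^{(k)}$ are independent of each other and of $\zeta_n,\xi_n$, and $\zeta_n^{(k)}$ has the conditional law of $\zeta_n$ given $U_{n-1}=V_{n-1}^{(k)}$. - Perturbed observations: $Z_n^{(k)}=Z_n+\xi_n^{(k)}$, with $\xi_n^{(k)}\sim\mathcal N(0,I_q)$ independent of each other and of everything else. - Forecast mean and covariance: $\overline{\widehat V}_n=\frac1K\sum_{k=1}^K\widehat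 V_n^{(k)}$, $\widehat C_n=\frac1{K-1}\sum_{k=1}^K(\widehat V_n^{(k)}-\overline{\widehat V}_n)\otimes(\widehat V_n^{(k)}-\overline{\widehat V}_n)$. - Inflated covariance: $\widetilde C_n=\widehat C_n+\lambda_nI_d$. - Analysis: $V_n^{(k)}=\widehat V_n^{(k)}-\widetilde C_nH^T(I+H\widetilde C_nH^T)^{-1}(H\widehat V_n^{(k)}-Z_n^{(k)})$. **Inflation statistics.** Write $\widehat V_n^{(k)}=(\widehat X_n^{(k)},\widehat Y_n^{(k)})$ with $\widehat X_n^{(k)}\in\mathbb{R}^q$ the first $q$ coordinates and $\widehat Y_n^{(k)}\in\mathbb{R}^{d-q}$ the remaining ones, with ensemble means $\overline{\widehat X}_n,\overline{\widehat Y}_n$. Define $$\Theta_n=\Big(\frac1K\sum_{k=1}^K|H\widehat V_n^{(k)}-Z_n^{(k)}|^2\Big)^{1/2},\qquad \Xi_n=\Big\|\frac1{K-1}\sum_{k=1}^K(\widehat X_n^{(k)}-\overline{\widehat X}_n)\otimes(\widehat Y_n^{(k)}-\overline{\widehat Y}_n)\Big\|,$$ $$\varphi(x,y)=c_\varphi\,x(1+y)\,\mathbf 1_{\{x>M_1\text{ or }y>M_2\}} .$$ The inflation strength $\lambda_n$ is a random variable measurable with respect to the $\sigma$-algebra generated by the initial data and all noises up to time $n$. **Notation.** $|\cdot|$ is the Euclidean norm, $\|\cdot\|$ the operator norm, $a\otimes b=ab^T$. $\mathbb{E}_{n}$ is conditional expectation given $\mathcal F_n=\sigma\{U_m,V_m^{(1)},\dots,V_m^{(K)}:m\le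 n\}$. *)

theory Defs
  imports "HOL-Probability.Probability"
begin

text \<open>
  The spaces \<open>R^d\<close> and \<open>R^q\<close> are \<open>real ^ 'd\<close> and \<open>real ^ 'q\<close> for finite linearly ordered
  index types (for instance numeral types), so that \<open>the first q coordinates\<close> of \<open>R^d\<close>
  are those of position less than \<open>CARD('q)\<close>. Positions start at \<open>0\<close>.
\<close>

type_synonym 'n rvec = "(real, 'n) vec"
type_synonym ('m, 'n) rmat = "((real, 'n) vec, 'm) vec"

definition coord_pos :: "'n :: {finite, linorder} \<Rightarrow> nat" where
  "coord_pos i = card {j. j < i}"

definition obs_matrix :: "('q :: {finite, linorder}) rvec \<Rightarrow> ('q, 'd :: {finite, linorder}) rmat" where
  "obs_matrix h = (\<chi> i j. if coord_pos j = coord_pos i then h $ i else 0)"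

definition rho0 :: "real ^ 'q \<Rightarrow> real" where
  "rho0 h = Min (range (\<lambda>i. (h $ i)\<^sup>2))"

definition op_norm :: "real ^ 'n ^ 'm \<Rightarrow> real" where
  "op_norm A = onorm ((*v) A)"

definition tensor :: "real ^ 'm \<Rightarrow> real ^ 'n \<Rightarrow> real ^ 'n ^ 'm"  (infixl "\<otimes>\<^sub>v" 75) where
  "a \<otimes>\<^sub>v b = (\<chi> i j. a $ i * b $ j)"

definition obs_part :: "('d :: {finite, linorder}) rvec \<Rightarrow> ('q :: {finite, linorder}) rvec" where
  "obs_part v = (\<chi> i. v $ (THE j. coord_pos j = coord_pos i))"

text \<open>
  There is no type of vectors of length \<open>d - q\<close> (in particular \<open>d = q\<close> is allowed), so the
  vector of the remaining coordinates is kept in \<open>R^d\<close>, with zeros in the first \<open>q\<close> places.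
  In a cross covariance this only adds zero columns, which do not affect the operator norm.
\<close>

definition unobs_part :: "nat \<Rightarrow> ('d :: {finite, linorder}) rvec \<Rightarrow> 'd rvec" where
  "unobs_part q v = (\<chi> j. if q \<le> coord_pos j then v $ j else 0)"

text \<open>Ensembles of size \<open>K\<close> are families indexed by \<open>{1..K}\<close>.\<close>

definition ens_mean :: "nat \<Rightarrow> (nat \<Rightarrow> 'a :: real_vector) \<Rightarrow> 'a" where
  "ens_mean K v = (1 / real K) *\<^sub>R (\<Sum>k = 1..K. v k)"

definition ens_cov :: "nat \<Rightarrow> (nat \<Rightarrow> real ^ 'm) \<Rightarrow> (nat \<Rightarrow> real ^ 'n) \<Rightarrow> real ^ 'n ^ 'm" where
  "ens_cov K x y =
     (1 / (real K - 1)) *\<^sub>R (\<Sum>k = 1..K. (x k - ens_mean K x) \<otimes>\<^sub>v (y k - ens_mean K y))"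

definition Theta :: "nat \<Rightarrow> real ^ 'd ^ 'q \<Rightarrow> (nat \<Rightarrow> real ^ 'd) \<Rightarrow> (nat \<Rightarrow> real ^ 'q) \<Rightarrow> real" where
  "Theta K H v z = sqrt ((1 / real K) * (\<Sum>k = 1..K. (norm (H *v v k - z k))\<^sup>2))"

definition Xi :: "'q :: {finite, linorder} itself \<Rightarrow> nat
    \<Rightarrow> (nat \<Rightarrow> ('d :: {finite, linorder}) rvec) \<Rightarrow> real" where
  "Xi _ K v =
     op_norm (ens_cov K (\<lambda>k. obs_part (v k) :: 'q rvec) (\<lambda>k. unobs_part CARD('q) (v k)))"

definition inflation_fun :: "real \<Rightarrow> real \<Rightarrow> real \<Rightarrow> real \<Rightarrow> real \<Rightarrow> real" where
  "inflation_fun c M1 M2 x y = (if x > M1 \<or> y > M2 then c * x * (1 + y) else 0)"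

definition inflated_cov :: "nat \<Rightarrow> real \<Rightarrow> (nat \<Rightarrow> real ^ 'd) \<Rightarrow> real ^ 'd ^ 'd" where
  "inflated_cov K l v = ens_cov K v v + l *\<^sub>R mat 1"

definition analysis :: "real ^ 'd ^ 'q \<Rightarrow> real ^ 'd ^ 'd \<Rightarrow> real ^ 'd \<Rightarrow> real ^ 'q \<Rightarrow> real ^ 'd" where
  "analysis H C v z =
     v - (C ** transpose H ** matrix_inv (mat 1 + H ** C ** transpose H)) *v (H *v v - z)"

definition std_gaussian :: "(real ^ 'q) measure" where
  "std_gaussian = density lborel (\<lambda>x. ennreal (\<Prod>i\<in>UNIV. std_normal_density (x $ i)))"

definition noise_cov :: "(real ^ 'd \<Rightarrow> (real ^ 'd) measure) \<Rightarrow> real ^ 'd \<Rightarrow> real ^ 'd ^ 'd" where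
  "noise_cov \<kappa> u = (\<chi> i j. \<integral>z. (z \<otimes>\<^sub>v z) $ i $ j \<partial>(\<kappa> u))"

definition events_of :: "'w measure \<Rightarrow> ('w \<Rightarrow> 'a :: topological_space) \<Rightarrow> 'w set set" where
  "events_of M X = {X -` A \<inter> space M | A. A \<in> sets borel}"

definition state_filtration ::
    "'w measure \<Rightarrow> nat \<Rightarrow> (nat \<Rightarrow> 'w \<Rightarrow> real ^ 'd) \<Rightarrow> (nat \<Rightarrow> nat \<Rightarrow> 'w \<Rightarrow> real ^ 'd)
      \<Rightarrow> nat \<Rightarrow> 'w measure" where
  "state_filtration M K U V n = sigma (space M)
     (\<Union>m\<in>{0..n}. events_of M (U m) \<union> (\<Union>k\<in>{1..K}. events_of M (V m k)))"

definition noise_filtration ::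
    "'w measure \<Rightarrow> nat \<Rightarrow> (nat \<Rightarrow> 'w \<Rightarrow> real ^ 'd) \<Rightarrow> (nat \<Rightarrow> nat \<Rightarrow> 'w \<Rightarrow> real ^ 'd)
      \<Rightarrow> (nat \<Rightarrow> 'w \<Rightarrow> real ^ 'd) \<Rightarrow> (nat \<Rightarrow> 'w \<Rightarrow> real ^ 'q)
      \<Rightarrow> (nat \<Rightarrow> nat \<Rightarrow> 'w \<Rightarrow> real ^ 'd) \<Rightarrow> (nat \<Rightarrow> nat \<Rightarrow> 'w \<Rightarrow> real ^ 'q)
      \<Rightarrow> nat \<Rightarrow> 'w measure" where
  "noise_filtration M K U V \<zeta> \<xi> \<zeta>e \<xi>e n = sigma (space M)
     (events_of M (U 0) \<union> (\<Union>k\<in>{1..K}. events_of M (V 0 k)) \<union>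
      (\<Union>m\<in>{1..n}. events_of M (\<zeta> m) \<union> events_of M (\<xi> m) \<union>
         (\<Union>k\<in>{1..K}. events_of M (\<zeta>e m k) \<union> events_of M (\<xi>e m k))))"

text \<open>
  \<open>\<kappa> u\<close> is the conditional law of the signal noise given that the previous state is \<open>u\<close>.
  The processes are the signal \<open>U\<close> with noise \<open>\<zeta>\<close>, the observation \<open>Z\<close> with noise \<open>\<xi>\<close>,
  the forecast ensemble \<open>Vf\<close> with noises \<open>\<zeta>e\<close>, the perturbed observations \<open>Ze\<close> with noises
  \<open>\<xi>e\<close>, the inflation strength \<open>lam\<close> and the analysis ensemble \<open>V\<close>.

  The assumption \<open>noise_law\<close> collects all distributional and independence hypotheses on the
  noises: given the initial data and the noises up to time \<open>n\<close>, the variables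
  \<open>\<zeta> (n+1)\<close>, \<open>\<xi> (n+1)\<close>, \<open>\<zeta>e (n+1) k\<close>, \<open>\<xi>e (n+1) k\<close> are jointly conditionally independent, with
  conditional laws \<open>\<kappa> (U n)\<close>, \<open>N(0,I)\<close>, \<open>\<kappa> (V n k)\<close>, \<open>N(0,I)\<close>. As the laws \<open>N(0,I)\<close> do not
  depend on the past, this makes the observation noises i.i.d. and independent of
  the past and of the model noises of the same step.
\<close>

locale enkf_ai = prob_space M
  for M :: "'w measure" +
  fixes \<Psi> :: "('d :: {finite, linorder}) rvec \<Rightarrow> 'd rvec"
    and \<kappa> :: "'d rvec \<Rightarrow> ('d rvec) measure"
    and h :: "('q :: {finite, linorder}) rvec"
    and K :: nat
    and U \<zeta> :: "nat \<Rightarrow> 'w \<Rightarrow> 'd rvec"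
    and Z \<xi> :: "nat \<Rightarrow> 'w \<Rightarrow> 'q rvec"
    and Vf \<zeta>e :: "nat \<Rightarrow> nat \<Rightarrow> 'w \<Rightarrow> 'd rvec"
    and Ze \<xi>e :: "nat \<Rightarrow> nat \<Rightarrow> 'w \<Rightarrow> 'q rvec"
    and lam :: "nat \<Rightarrow> 'w \<Rightarrow> real"
    and V :: "nat \<Rightarrow> nat \<Rightarrow> 'w \<Rightarrow> 'd rvec"
  assumes dims: "CARD('q) \<le> CARD('d)"
    and h_pos: "h $ i > 0"
    and K_ge_2: "K \<ge> 2"
    and Psi_measurable: "\<Psi> \<in> borel \<rightarrow>\<^sub>M borel"
    and kernel: "\<kappa> \<in> borel \<rightarrow>\<^sub>M prob_algebra borel"
    and kernel_second_moment: "integrable (\<kappa> u) (\<lambda>z. (norm z)\<^sup>2)"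
    and kernel_mean: "(\<integral>z. z \<partial>(\<kappa> u)) = 0"
    and init_measurable:
      "U 0 \<in> M \<rightarrow>\<^sub>M borel"
      "k \<in> {1..K} \<Longrightarrow> V 0 k \<in> M \<rightarrow>\<^sub>M borel"
    and noise_measurable:
      "\<zeta> (Suc n) \<in> M \<rightarrow>\<^sub>M borel"
      "\<xi> (Suc n) \<in> M \<rightarrow>\<^sub>M borel"
      "k \<in> {1..K} \<Longrightarrow> \<zeta>e (Suc n) k \<in> M \<rightarrow>\<^sub>M borel"
      "k \<in> {1..K} \<Longrightarrow> \<xi>e (Suc n) k \<in> M \<rightarrow>\<^sub>M borel"
    and noise_law:
      "\<lbrakk>A \<in> sets borel; B \<in> sets borel;
        \<And>k. k \<in> {1..K} \<Longrightarrow> Ae k \<in> sets borel; \<And>k. k \<in> {1..K} \<Longrightarrow> Be k \<in> sets borel\<rbrakk>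
       \<Longrightarrow> AE \<omega> in M.
             real_cond_exp M (noise_filtration M K U V \<zeta> \<xi> \<zeta>e \<xi>e n)
               (indicator {\<omega> \<in> space M. \<zeta> (Suc n) \<omega> \<in> A \<and> \<xi> (Suc n) \<omega> \<in> B \<and>
                  (\<forall>k\<in>{1..K}. \<zeta>e (Suc n) k \<omega> \<in> Ae k \<and> \<xi>e (Suc n) k \<omega> \<in> Be k)}) \<omega>
             = measure (\<kappa> (U n \<omega>)) A * measure std_gaussian B *
               (\<Prod>k = 1..K. measure (\<kappa> (V n k \<omega>)) (Ae k) * measure std_gaussian (Be k))"
    and lam_measurable:
      "lam (Suc n) \<in> noise_filtration M K U V \<zeta> \<xi> \<zeta>e \<xi>e (Suc n) \<rightarrow>\<^sub>M borel"
    and signal: "\<omega> \<in> space M \<Longrightarrow> U (Suc n) \<omega> = \<Psi> (U n \<omega>) + \<zeta> (Suc n) \<omega>"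
    and observation:
      "\<omega> \<in> space M \<Longrightarrow> Z (Suc n) \<omega> = obs_matrix h *v U (Suc n) \<omega> + \<xi> (Suc n) \<omega>"
    and forecast:
      "\<lbrakk>\<omega> \<in> space M; k \<in> {1..K}\<rbrakk> \<Longrightarrow> Vf (Suc n) k \<omega> = \<Psi> (V n k \<omega>) + \<zeta>e (Suc n) k \<omega>"
    and perturbed_observation:
      "\<lbrakk>\<omega> \<in> space M; k \<in> {1..K}\<rbrakk> \<Longrightarrow> Ze (Suc n) k \<omega> = Z (Suc n) \<omega> + \<xi>e (Suc n) k \<omega>"
    and analysis_step:
      "\<lbrakk>\<omega> \<in> space M; k \<in> {1..K}\<rbrakk> \<Longrightarrow>
         V (Suc n) k \<omega> =
           analysis (obs_matrix h) (inflated_cov K (lam (Suc n) \<omega>) (\<lambda>j. Vf (Suc n) j \<omega>))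
             (Vf (Suc n) k \<omega>) (Ze (Suc n) k \<omega>)"

definition energy_principle ::
    "(real ^ 'd \<Rightarrow> real ^ 'd) \<Rightarrow> (real ^ 'd \<Rightarrow> (real ^ 'd) measure) \<Rightarrow> real \<Rightarrow> real \<Rightarrow> bool" where
  "energy_principle \<Psi> \<kappa> \<beta> Kh \<longleftrightarrow>
     0 < \<beta> \<and> \<beta> < 1 \<and> 0 < Kh \<and>
     (\<forall>u. (norm (\<Psi> u))\<^sup>2 + trace (noise_cov \<kappa> u) \<le> (1 - \<beta>) * (norm u)\<^sup>2 + Kh)"

definition total_energy ::
    "nat \<Rightarrow> ('q :: {finite, linorder}) rvec \<Rightarrow> real \<Rightarrow> ('d :: {finite, linorder}) rvec
      \<Rightarrow> (nat \<Rightarrow> 'd rvec) \<Rightarrow> real" where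
  "total_energy K h \<beta> u v =
     4 * real K * inverse (rho0 h) * inverse \<beta> * (op_norm (obs_matrix h :: ('q, 'd) rmat))\<^sup>2 * (norm u)\<^sup>2
     + (\<Sum>k = 1..K. (norm (v k))\<^sup>2)"

end

(* Write H for the observation matrix, C for the inflated covariance and S = H C H^T. The analysis
   innovation w = H V - Z solves (I + S) w = r with r the forecast innovation, and S is bounded below
   by lambda rho_0 because the ensemble covariance is positive semidefinite; hence
   |w| <= |r| / (1 + lambda rho_0), where |r| <= sqrt K Theta. The inflation function is chosen such
   that Theta and Theta Xi, divided by 1 + lambda rho_0, stay bounded. The former gives (i). As the
   inflation does not enter the cross covariance, the latter shows that the analysis moves the
   unobserved coordinates by a bounded amount. So, up to constants and Gaussian terms, the observed
   part of V is controlled by H U and the unobserved part by that of the forecast, and the weight of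
   |U|^2 in the energy lets the observed part be absorbed into the contraction of the signal. *)

theory Submission
  imports Defs
begin

section \<open>Observed and unobserved coordinates\<close>

text \<open>The two factors of \<open>inflation_fun\<close> answer two demands: \<open>x\<close>
  keeps the analysis innovation bounded, and \<open>1 + y\<close> pays for the cross covariance
  through which that innovation reaches the unobserved coordinates. Those coordinates have no
  observation to control them, so the contraction of the forecast must do it alone. It may be
  spoiled by a factor \<open>1 + \<beta> / 2\<close> and no more, since
  \<open>(1 + \<beta> / 2) * (1 - \<beta>) \<le> 1 - \<beta> / 2\<close>. The same slack
  \<open>\<beta> / 2\<close> dictates the weight of the signal in the energy. The probabilistic
  obstacle is that the noise laws are given relative to the filtration \<open>\<G> n\<close> of the
  noises, whereas the drift is conditioned on the filtration \<open>\<F> n\<close> of the states.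
  Comparing the two needs adapted states, hence a measurable analysis step, matrix inverse included.
  The estimate is made under \<open>\<G> n\<close>; its bound is a function of the state at time
  \<open>n\<close>, so the tower property carries it down to \<open>\<F> n\<close>. Energies are
  treated as \<open>ennreal\<close>, so that the drift makes sense before any expectation is known
  to be finite.\<close>

lemma coord_pos_less_iff: "coord_pos i < coord_pos j \<longleftrightarrow> i < (j :: 'n :: {finite, linorder})"
proof -
  have mono: "coord_pos i < coord_pos j" if "i < j" for i j :: 'n
    unfolding coord_pos_def using that by (intro psubset_card_mono) auto
  show ?thesis
    using mono[of i j] mono[of j i] by (cases i j rule: linorder_cases) auto
qed

lemma inj_coord_pos: "inj (coord_pos :: 'n :: {finite, linorder} \<Rightarrow> nat)"
  by (rule injI) (metis coord_pos_less_iff less_irrefl linorder_neqE)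

lemma range_coord_pos: "range (coord_pos :: 'n :: {finite, linorder} \<Rightarrow> nat) = {..<CARD('n)}"
proof (rule card_subset_eq)
  have "coord_pos i < CARD('n)" for i :: 'n
    unfolding coord_pos_def by (rule psubset_card_mono) auto
  then show "range (coord_pos :: 'n \<Rightarrow> nat) \<subseteq> {..<CARD('n)}" by auto
qed (simp_all add: card_image inj_coord_pos)

text \<open>The identification of coordinates hidden in the description operator of
  \<open>obs_part\<close>, given a name so that injectivity and range can be stated. It is
  meaningful only under \<open>dims\<close>.\<close>

definition coord_emb :: "'q :: {finite, linorder} \<Rightarrow> 'd :: {finite, linorder}" where
  "coord_emb i = (THE j. coord_pos j = coord_pos i)"

context
  fixes q_type :: "'q :: {finite, linorder} itself" and d_type :: "'d :: {finite, linorder} itself"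
  assumes dims: "CARD('q) \<le> CARD('d)"
begin

text \<open>Positions fill an initial segment of the naturals for both index types, so by
  \<open>dims\<close> each position of \<open>'q\<close> occurs in \<open>'d\<close>, and by
  injectivity only once. This makes every sum against \<open>obs_matrix\<close> collapse to a single
  term.\<close>

lemma coord_pos_eq_iff: "coord_pos j = coord_pos i \<longleftrightarrow> j = coord_emb i" for i :: 'q and j :: 'd
proof -
  have "coord_pos i \<in> range (coord_pos :: 'q \<Rightarrow> nat)" by simp
  then have "coord_pos i \<in> range (coord_pos :: 'd \<Rightarrow> nat)"
    using dims unfolding range_coord_pos by simp
  then obtain j0 :: 'd where j0: "coord_pos j0 = coord_pos i" by (metis imageE)
  have eq: "coord_pos j = coord_pos i \<longleftrightarrow> j = j0" for j :: 'd
    unfolding j0[symmetric] using inj_coord_pos by (auto dest: injD)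
  have "coord_emb i = j0" unfolding coord_emb_def eq by simp
  with eq show ?thesis by simp
qed

lemma inj_coord_emb: "inj (coord_emb :: 'q \<Rightarrow> 'd)"
  by (rule injI) (metis coord_pos_eq_iff injD inj_coord_pos)

lemma range_coord_emb: "range (coord_emb :: 'q \<Rightarrow> 'd) = {j. coord_pos j < CARD('q)}"
proof (intro set_eqI iffI)
  fix j :: 'd assume "j \<in> range (coord_emb :: 'q \<Rightarrow> 'd)"
  then obtain i :: 'q where "coord_pos j = coord_pos i" using coord_pos_eq_iff by blast
  then show "j \<in> {j. coord_pos j < CARD('q)}"
    using range_coord_pos[where 'n = 'q] by auto
next
  fix j :: 'd assume "j \<in> {j. coord_pos j < CARD('q)}"
  then have "coord_pos j \<in> range (coord_pos :: 'q \<Rightarrow> nat)"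
    unfolding range_coord_pos by simp
  then show "j \<in> range (coord_emb :: 'q \<Rightarrow> 'd)" using coord_pos_eq_iff by auto
qed

lemma obs_part_nth: "(obs_part v :: 'q rvec) $ i = v $ coord_emb i" for v :: "'d rvec"
  by (simp add: obs_part_def coord_emb_def)

lemma obs_matrix_mult_nth:
  "((obs_matrix h :: ('q, 'd) rmat) *v v) $ i = h $ i * (obs_part v :: 'q rvec) $ i"
  by (simp add: matrix_vector_mult_def obs_matrix_def coord_pos_eq_iff obs_part_nth if_distrib
      if_distribR cong: if_cong)

lemma obs_part_transpose_mult:
  "(obs_part (transpose (obs_matrix h :: ('q, 'd) rmat) *v x) :: 'q rvec) $ i = h $ i * x $ i"
  by (simp add: matrix_vector_mult_def obs_matrix_def coord_pos_eq_iff obs_part_nth transpose_def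
      inj_eq[OF inj_coord_emb] if_distrib if_distribR cong: if_cong)

text \<open>Row positions stay below \<open>CARD('q)\<close>, so no row of the observation matrix
  meets an unobserved coordinate. Hence an added multiple of the identity, applied to such a vector,
  is invisible in the unobserved coordinates.\<close>

lemma unobs_part_transpose_mult:
  "unobs_part CARD('q) (transpose (obs_matrix h :: ('q, 'd) rmat) *v x) = 0"
proof -
  have "coord_pos j \<noteq> coord_pos i" if "CARD('q) \<le> coord_pos j" for j :: 'd and i :: 'q
    using that range_coord_pos[where 'n = 'q] by (metis lessThan_iff not_less rangeI)
  then show ?thesis
    by (simp add: vec_eq_iff unobs_part_def matrix_vector_mult_def transpose_def obs_matrix_def)
qed

lemma inner_obs_unobs:
  "u \<bullet> v = (obs_part u :: 'q rvec) \<bullet> obs_part v + unobs_part CARD('q) u \<bullet> unobs_part CARD('q) v"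
  for u v :: "'d rvec"
proof -
  have "(\<Sum>j | coord_pos j < CARD('q). u $ j * v $ j) =
      (\<Sum>j\<in>range (coord_emb :: 'q \<Rightarrow> 'd). u $ j * v $ j)"
    by (simp only: range_coord_emb)
  also have "\<dots> = (\<Sum>i::'q\<in>UNIV. u $ coord_emb i * v $ coord_emb i)"
    by (simp add: sum.reindex[OF inj_coord_emb])
  finally have obs: "(obs_part u :: 'q rvec) \<bullet> obs_part v =
      (\<Sum>j | coord_pos j < CARD('q). u $ j * v $ j)"
    by (simp add: inner_vec_def obs_part_nth)
  have "unobs_part CARD('q) u \<bullet> unobs_part CARD('q) v =
      (\<Sum>j | \<not> coord_pos j < CARD('q). u $ j * v $ j)"
    unfolding inner_vec_def unobs_part_def
    by (rule sum.mono_neutral_cong_right) auto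
  with obs show ?thesis
    unfolding inner_vec_def[of u v]
    using sum.union_disjoint[of "{j::'d. coord_pos j < CARD('q)}"
        "{j. \<not> coord_pos j < CARD('q)}" "\<lambda>j. u $ j * v $ j"]
    by (auto simp: set_eq_iff Un_def)
qed

lemma norm_obs_unobs:
  "(norm v)\<^sup>2 = (norm (obs_part v :: 'q rvec))\<^sup>2 + (norm (unobs_part CARD('q) v))\<^sup>2"
  for v :: "'d rvec"
  by (simp add: power2_norm_eq_inner inner_obs_unobs[symmetric])

lemma norm_obs_part_le: "norm (obs_part v :: 'q rvec) \<le> norm v" for v :: "'d rvec"
  by (rule power2_le_imp_le) (simp_all add: norm_obs_unobs[of v])

lemma norm_unobs_part_le: "norm (unobs_part CARD('q) v) \<le> norm v" for v :: "'d rvec"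
  by (rule power2_le_imp_le) (simp_all add: norm_obs_unobs[of v])

end

lemma linear_obs_part: "linear obs_part"
  by (rule linearI) (simp_all add: obs_part_def vec_eq_iff)

lemma linear_unobs_part: "linear (unobs_part q)"
  by (rule linearI) (simp_all add: unobs_part_def vec_eq_iff)

section \<open>The analysis step\<close>

lemma linear_ens_mean: "linear f \<Longrightarrow> ens_mean K (\<lambda>k. f (v k)) = f (ens_mean K v)"
  by (simp add: ens_mean_def linear_scale linear_sum)

lemma tensor_mult: "(a \<otimes>\<^sub>v b) *v u = (b \<bullet> u) *\<^sub>R a"
  by (simp add: vec_eq_iff tensor_def matrix_vector_mult_def inner_vec_def sum_distrib_left mult_ac)

lemma transpose_tensor: "transpose (a \<otimes>\<^sub>v b) = b \<otimes>\<^sub>v a"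
  by (simp add: vec_eq_iff tensor_def transpose_def mult.commute)

lemma sum_matrix_mult: "(\<Sum>k\<in>A. B k) *v u = (\<Sum>k\<in>A. B k *v u)" for B :: "'a \<Rightarrow> real ^ 'n ^ 'm"
  by (induction A rule: infinite_finite_induct) (simp_all add: matrix_vector_mult_add_rdistrib)

lemma ens_cov_mult:
  "ens_cov K x y *v u =
    (1 / (real K - 1)) *\<^sub>R (\<Sum>k = 1..K. ((y k - ens_mean K y) \<bullet> u) *\<^sub>R (x k - ens_mean K x))"
  by (simp add: ens_cov_def scaleR_matrix_vector_assoc[symmetric] sum_matrix_mult tensor_mult)

lemma transpose_ens_cov: "transpose (ens_cov K x y) = ens_cov K y x"
proof -
  have lin: "linear (transpose :: real ^ 'n ^ 'm \<Rightarrow> _)"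
    by (rule linearI) (simp_all add: transpose_def vec_eq_iff)
  show ?thesis
    by (simp only: ens_cov_def linear_scale[OF lin] linear_sum[OF lin] transpose_tensor)
qed

lemma ens_cov_self_nonneg: "K \<ge> 2 \<Longrightarrow> 0 \<le> u \<bullet> (ens_cov K x x *v u)"
  by (auto simp: ens_cov_mult inner_sum_right inner_commute intro!: divide_nonneg_nonneg sum_nonneg)

lemma inflated_cov_mult: "inflated_cov K l v *v u = ens_cov K v v *v u + l *\<^sub>R u"
  by (simp add: inflated_cov_def matrix_vector_mult_add_rdistrib scaleR_matrix_vector_assoc[symmetric])

lemma norm_mult_le_op_norm: "norm (A *v x) \<le> op_norm A * norm x"
  unfolding op_norm_def by (rule onorm) (rule matrix_vector_mul_bounded_linear)

lemma op_norm_nonneg: "0 \<le> op_norm A"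
  unfolding op_norm_def by (rule onorm_pos_le) (rule matrix_vector_mul_bounded_linear)

lemma inner_transpose_mult: "(transpose A *v x) \<bullet> y = x \<bullet> (A *v y)" for A :: "real ^ 'n ^ 'm"
  by (metis dot_lmul_matrix transpose_matrix_vector)

text \<open>With \<open>y\<close> the transpose applied to \<open>x\<close>,
  \<open>|y|^2 = x \<bullet> (A *v y)\<close> is at most \<open>|x| * op_norm A * |y|\<close>, and
  one factor \<open>|y|\<close> cancels. It is needed because \<open>Xi\<close> measures the
  covariance from unobserved to observed coordinates, while the analysis acts through its
  transpose.\<close>

lemma norm_transpose_mult_le_op_norm: "norm (transpose A *v x) \<le> op_norm A * norm x"
proof -
  have "norm (transpose A *v x) * norm (transpose A *v x) = x \<bullet> (A *v (transpose A *v x))"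
    by (metis inner_transpose_mult power2_eq_square power2_norm_eq_inner)
  also have "\<dots> \<le> norm x * norm (A *v (transpose A *v x))" by (rule norm_cauchy_schwarz)
  also have "\<dots> \<le> norm x * (op_norm A * norm (transpose A *v x))"
    by (intro mult_left_mono norm_mult_le_op_norm) simp
  finally have "norm (transpose A *v x) * norm (transpose A *v x)
      \<le> (op_norm A * norm x) * norm (transpose A *v x)" by (simp add: mult_ac)
  then show ?thesis
    by (cases "transpose A *v x = 0") (auto simp: op_norm_nonneg)
qed

text \<open>Coercivity is used twice: it makes the kernel of \<open>I + S\<close> trivial, so that
  \<open>matrix_inv\<close> is a true inverse, and tested with the solution it gives the bound. The
  update becomes a multiple of the analysis innovation \<open>w\<close>, which is the small
  quantity, instead of the forecast innovation.\<close>

lemma analysis_innovation: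
  fixes H :: "real ^ 'd ^ 'q" and C :: "real ^ 'd ^ 'd" and v :: "real ^ 'd" and z :: "real ^ 'q"
  assumes coercive: "\<And>x. \<mu> * (norm x)\<^sup>2 \<le> x \<bullet> (H *v (C *v (transpose H *v x)))" and "0 \<le> \<mu>"
  defines "w \<equiv> H *v analysis H C v z - z"
  shows "analysis H C v z = v - C *v (transpose H *v w)"
    and "(1 + \<mu>) * norm w \<le> norm (H *v v - z)"
proof -
  define S where "S = H ** C ** transpose H"
  define r where "r = H *v v - z"
  have S: "S *v x = H *v (C *v (transpose H *v x))" for x
    by (simp add: S_def matrix_vector_mul_assoc matrix_mul_assoc del: transpose_matrix_vector)
  have lower: "(1 + \<mu>) * (norm x)\<^sup>2 \<le> x \<bullet> ((mat 1 + S) *v x)" for x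
    using coercive[of x]
    by (simp add: S matrix_vector_mult_add_rdistrib inner_add_right power2_norm_eq_inner algebra_simps)
  have "x = 0" if "(mat 1 + S) *v x = 0" for x
  proof -
    have "(1 + \<mu>) * (norm x)\<^sup>2 \<le> 0" using lower[of x] that by simp
    then show ?thesis using \<open>0 \<le> \<mu>\<close> by (simp add: mult_le_0_iff)
  qed
  then have "invertible (mat 1 + S)"
    unfolding invertible_left_inverse matrix_left_invertible_ker by blast
  then have inv: "(mat 1 + S) ** matrix_inv (mat 1 + S) = mat 1"
    unfolding invertible_def matrix_inv_def by (rule someI2_ex) simp
  define y where "y = matrix_inv (mat 1 + S) *v r"
  have y: "(mat 1 + S) *v y = r"
    by (simp add: y_def matrix_vector_mul_assoc inv)
  have an: "analysis H C v z = v - C *v (transpose H *v y)"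
    by (simp add: analysis_def y_def r_def S_def matrix_vector_mul_assoc matrix_mul_assoc
        del: transpose_matrix_vector)
  \<comment> \<open>The update subtracts \<open>S *v y\<close> from the innovation, and
    \<open>r - S *v y = y\<close> is the equation solved by \<open>y\<close>.\<close>
  have "w = r - S *v y"
    unfolding w_def an r_def S by (simp add: matrix_vector_mult_diff_distrib)
  also have "\<dots> = y" using y by (simp add: matrix_vector_mult_add_rdistrib algebra_simps)
  finally have "w = y" .
  with an show "analysis H C v z = v - C *v (transpose H *v w)" by simp
  have "(1 + \<mu>) * (norm y)\<^sup>2 \<le> norm y * norm r"
    using lower[of y] norm_cauchy_schwarz[of y r] unfolding y by linarith
  then have "norm y * ((1 + \<mu>) * norm y) \<le> norm y * norm r" by (simp add: power2_eq_square mult_ac)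
  then have "(1 + \<mu>) * norm y \<le> norm r"
    by (cases "y = 0") auto
  with \<open>w = y\<close> show "(1 + \<mu>) * norm w \<le> norm (H *v v - z)" by (simp add: r_def)
qed

section \<open>Strength of the inflation against innovation and cross covariance\<close>

lemma rho0_le: "rho0 h \<le> (h $ i)\<^sup>2"
  unfolding rho0_def by (rule Min_le) auto

lemma rho0_pos: "(\<And>i. h $ i > 0) \<Longrightarrow> 0 < rho0 h"
  unfolding rho0_def by (subst Min_gr_iff) (auto simp: less_imp_neq[symmetric] simp del: zero_less_power2)

text \<open>The observation matrix is diagonal on the observed coordinates. This form serves both
  \<open>H\<close>, to recover the observed part of a vector, and its transpose, to get
  coercivity.\<close>

lemma rho0_norm_le: "(\<And>i. y $ i = h $ i * x $ i) \<Longrightarrow> rho0 h * (norm x)\<^sup>2 \<le> (norm y)\<^sup>2"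
  unfolding power2_norm_eq_inner inner_vec_def sum_distrib_left
  by (intro sum_mono) (simp add: mult_right_mono rho0_le flip: power2_eq_square, simp add: power_mult_distrib mult_right_mono rho0_le)

text \<open>A single member is bounded by the whole sum of squares, which is \<open>K\<close> times
  the square of \<open>Theta\<close>; this is the origin of \<open>sqrt K\<close> in the
  bounds.\<close>

lemma norm_le_Theta:
  assumes "k \<in> {1..K}"
  shows "norm (H *v v k - z k) \<le> sqrt (real K) * Theta K H v z"
proof -
  have "(norm (H *v v k - z k))\<^sup>2 \<le> (\<Sum>k = 1..K. (norm (H *v v k - z k))\<^sup>2)"
    by (rule member_le_sum[OF assms]) auto
  also have "\<dots> = (sqrt (real K) * Theta K H v z)\<^sup>2"
    using assms by (simp add: Theta_def power_mult_distrib sum_nonneg)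
  finally show ?thesis
    by (rule power2_le_imp_le) (simp add: Theta_def sum_nonneg)
qed

lemma Theta_nonneg: "0 \<le> Theta K H v z"
  by (simp add: Theta_def sum_nonneg)

lemma Xi_nonneg: "0 \<le> Xi t K v"
  by (simp add: Xi_def op_norm_nonneg)

text \<open>The numerator is at most \<open>l / c\<close>, and
  \<open>l / (1 + l * s) \<le> 1 / s\<close>. With the factor \<open>1 + y\<close> in the numerator,
  one inequality covers both \<open>x\<close> and \<open>x * y\<close>.\<close>

lemma mult_le_inverse_of_inflation:
  fixes c s x y l :: real
  assumes "0 < c" "0 < s" "0 \<le> x" "0 \<le> y" "c * x * (1 + y) \<le> l"
  shows "x * (1 + y) / (1 + l * s) \<le> inverse s * inverse c"
proof -
  have "c * x * (1 + y) * s \<le> l * s" by (rule mult_right_mono) (use assms in auto)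
  moreover have "0 \<le> c * x * (1 + y)" using assms by simp
  moreover have "0 \<le> l * s" using calculation(2) assms by (intro mult_nonneg_nonneg) linarith+
  ultimately have "x * (1 + y) \<le> inverse s * inverse c * (1 + l * s)" "0 < 1 + l * s"
    using assms by (simp_all add: field_simps add_pos_nonneg)
  then show ?thesis by (simp add: pos_divide_le_eq)
qed

lemma inflation_fun_nonneg:
  "0 \<le> c \<Longrightarrow> 0 \<le> x \<Longrightarrow> 0 \<le> y \<Longrightarrow> 0 \<le> inflation_fun c M1 M2 x y"
  by (simp add: inflation_fun_def)

text \<open>Both bounds rest on a dichotomy. If a threshold is exceeded, the inflation is active and
  the product of \<open>Theta\<close> with \<open>1 + Xi\<close>, damped by
  \<open>1 + l * rho0 h\<close>, is at most \<open>inverse (rho0 h) * inverse c\<close>. Otherwise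
  the damping is dropped and the thresholds themselves bound \<open>Theta\<close> and
  \<open>Theta * Xi\<close>; hence \<open>M1\<close> in one maximum and \<open>M1 * M2\<close> in
  the other.\<close>

lemma analysis_ensemble_bounds:
  fixes h :: "('q :: {finite, linorder}) rvec" and v :: "nat \<Rightarrow> ('d :: {finite, linorder}) rvec"
    and z :: "nat \<Rightarrow> 'q rvec" and K :: nat and l :: real
  defines "H \<equiv> (obs_matrix h :: ('q, 'd) rmat)"
  defines "a \<equiv> \<lambda>k. analysis H (inflated_cov K l v) (v k) (z k)"
  assumes dims: "CARD('q) \<le> CARD('d)" and h_pos: "\<And>i. h $ i > 0" and "K \<ge> 2" "k \<in> {1..K}"
    and "c > 0" "M1 > 0" "M2 > 0"
    and l: "l \<ge> inflation_fun c M1 M2 (Theta K H v z) (Xi TYPE('q) K v)"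
  shows "norm (H *v a k - z k) \<le> sqrt (real K) * max M1 (inverse (rho0 h) * inverse c)"
    and "norm (unobs_part CARD('q) (a k) - unobs_part CARD('q) (v k))
      \<le> op_norm H * sqrt (real K) * max (M1 * M2) (inverse (rho0 h) * inverse c)"
proof -
  define C where "C = ens_cov K v v"
  define \<theta> where "\<theta> = Theta K H v z"
  define \<eta> where "\<eta> = Xi TYPE('q) K v"
  define s where "s = rho0 h"
  define w where "w = H *v a k - z k"
  have s: "0 < s" unfolding s_def using h_pos by (rule rho0_pos)
  have \<theta>: "0 \<le> \<theta>" and \<eta>: "0 \<le> \<eta>" by (simp_all add: \<theta>_def \<eta>_def Theta_nonneg Xi_nonneg)
  have l': "inflation_fun c M1 M2 \<theta> \<eta> \<le> l" using l by (simp add: \<theta>_def \<eta>_def)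
  have l0: "0 \<le> l" using l' inflation_fun_nonneg[of c \<theta> \<eta> M1 M2] \<open>c > 0\<close> \<theta> \<eta> by linarith
  have sl: "0 < 1 + l * s" using s l0 by (simp add: add_pos_nonneg)
  have div_le: "x / (1 + l * s) \<le> x" if "0 \<le> x" for x
    using divide_left_mono[of 1 "1 + l * s" x] that s l0 sl by simp
  have coercive: "l * s * (norm x)\<^sup>2 \<le> x \<bullet> (H *v (inflated_cov K l v *v (transpose H *v x)))" for x
  proof -
    define y where "y = transpose H *v x"
    have "s * (norm x)\<^sup>2 \<le> (norm (obs_part y :: 'q rvec))\<^sup>2"
      unfolding s_def y_def H_def
      by (rule rho0_norm_le) (rule obs_part_transpose_mult[OF dims])
    also have "\<dots> \<le> (norm y)\<^sup>2" by (simp add: norm_obs_unobs[OF dims, of y])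
    finally have "l * (s * (norm x)\<^sup>2) \<le> l * (y \<bullet> y)"
      using l0 by (intro mult_left_mono) (simp_all add: power2_norm_eq_inner)
    also have "\<dots> \<le> y \<bullet> (inflated_cov K l v *v y)"
      using ens_cov_self_nonneg[OF \<open>K \<ge> 2\<close>, of y v]
      by (simp add: inflated_cov_mult inner_add_right)
    also have "\<dots> = x \<bullet> (H *v (inflated_cov K l v *v y))"
      by (simp only: y_def inner_transpose_mult)
    finally show ?thesis by (simp only: y_def mult.assoc)
  qed
  have a: "a k = v k - inflated_cov K l v *v (transpose H *v w)"
    unfolding a_def w_def using coercive by (rule analysis_innovation(1)) (use s l0 in simp)
  have "(1 + l * s) * norm w \<le> norm (H *v v k - z k)"
    unfolding a_def w_def using coercive by (rule analysis_innovation(2)) (use s l0 in simp)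
  also have "\<dots> \<le> sqrt (real K) * \<theta>" unfolding \<theta>_def by (rule norm_le_Theta) fact
  finally have w: "norm w \<le> sqrt (real K) * (\<theta> / (1 + l * s))"
    using sl by (simp add: field_simps)
  have infl: "\<theta> * (1 + \<eta>) / (1 + l * s) \<le> inverse s * inverse c" if "\<theta> > M1 \<or> \<eta> > M2"
    using that l' \<open>c > 0\<close> s \<theta> \<eta> by (intro mult_le_inverse_of_inflation) (auto simp: inflation_fun_def)
  have le_max: "\<theta> * y / (1 + l * s) \<le> max m (inverse s * inverse c)"
    if "0 \<le> y" "y \<le> 1 + \<eta>" "\<not> (\<theta> > M1 \<or> \<eta> > M2) \<Longrightarrow> \<theta> * y \<le> m" for y m
  proof (cases "\<theta> > M1 \<or> \<eta> > M2")
    case True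
    have "\<theta> * y / (1 + l * s) \<le> \<theta> * (1 + \<eta>) / (1 + l * s)"
      using that sl \<theta> by (intro divide_right_mono mult_left_mono) auto
    with infl[OF True] show ?thesis by (simp add: le_max_iff_disj)
  next
    case False
    have "\<theta> * y / (1 + l * s) \<le> \<theta> * y" using that(1) \<theta> by (intro div_le) simp
    with that(3)[OF False] show ?thesis by (simp add: le_max_iff_disj)
  qed
  have "\<theta> / (1 + l * s) \<le> max M1 (inverse s * inverse c)"
  proof (cases "\<theta> > M1")
    case True
    have "\<theta> * 1 / (1 + l * s) \<le> \<theta> * (1 + \<eta>) / (1 + l * s)"
      using \<eta> sl \<theta> by (intro divide_right_mono mult_left_mono) auto
    with infl True show ?thesis by (simp add: le_max_iff_disj)
  next
    case False
    have "\<theta> / (1 + l * s) \<le> \<theta>" using \<theta> by (rule div_le)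
    with False show ?thesis by (simp add: le_max_iff_disj)
  qed
  then have "sqrt (real K) * (\<theta> / (1 + l * s)) \<le> sqrt (real K) * max M1 (inverse s * inverse c)"
    by (rule mult_left_mono) simp
  with w show "norm (H *v a k - z k) \<le> sqrt (real K) * max M1 (inverse (rho0 h) * inverse c)"
    unfolding w_def s_def by (rule order_trans)

  define u where "u = transpose H *v w"
  have unobs_u: "unobs_part CARD('q) u = 0"
    unfolding u_def H_def by (rule unobs_part_transpose_mult[OF dims])
  \<comment> \<open>\<open>B\<close> is the matrix whose norm is \<open>Xi\<close>. As
    \<open>u\<close> has only observed components, the unobserved part of \<open>C *v u\<close>
    involves just this block, transposed.\<close>
  define B where "B = ens_cov K (\<lambda>k. obs_part (v k) :: 'q rvec) (\<lambda>k. unobs_part CARD('q) (v k))"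
  have cov: "unobs_part CARD('q) (C *v u) = transpose B *v (obs_part u :: 'q rvec)"
  proof -
    have "(v i - ens_mean K v) \<bullet> u =
        (obs_part (v i) - ens_mean K (\<lambda>k. obs_part (v k))) \<bullet> (obs_part u :: 'q rvec)" for i
      using inner_obs_unobs[OF dims, of "v i - ens_mean K v" u] unobs_u
      by (simp add: linear_ens_mean[OF linear_obs_part] linear_diff[OF linear_obs_part])
    then show ?thesis
      unfolding B_def C_def transpose_ens_cov ens_cov_mult
      by (simp add: linear_ens_mean[OF linear_unobs_part] linear_diff[OF linear_unobs_part]
          linear_scale[OF linear_unobs_part] linear_sum[OF linear_unobs_part])
  qed
  \<comment> \<open>The inflation contributes \<open>l *\<^sub>R u\<close>, whose unobserved part is
    zero, so a large \<open>l\<close> does no harm here.\<close>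
  have "unobs_part CARD('q) (a k) - unobs_part CARD('q) (v k)
      = - (transpose B *v (obs_part u :: 'q rvec))"
    unfolding a u_def[symmetric] inflated_cov_mult C_def[symmetric] cov[symmetric]
    by (simp add: linear_diff[OF linear_unobs_part] linear_add[OF linear_unobs_part]
        linear_scale[OF linear_unobs_part] unobs_u)
  then have "norm (unobs_part CARD('q) (a k) - unobs_part CARD('q) (v k))
      = norm (transpose B *v (obs_part u :: 'q rvec))" by (simp only: norm_minus_cancel)
  also have "\<dots> \<le> \<eta> * norm (obs_part u :: 'q rvec)"
    unfolding \<eta>_def Xi_def B_def[symmetric] by (rule norm_transpose_mult_le_op_norm)
  also have "\<dots> \<le> \<eta> * norm u"
    using \<eta> by (intro mult_left_mono norm_obs_part_le[OF dims])
  also have "\<dots> \<le> \<eta> * (op_norm H * norm w)"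
    unfolding u_def using \<eta> by (intro mult_left_mono norm_transpose_mult_le_op_norm)
  also have "\<dots> \<le> \<eta> * (op_norm H * (sqrt (real K) * (\<theta> / (1 + l * s))))"
    using w \<eta> by (intro mult_left_mono op_norm_nonneg)
  also have "\<dots> = op_norm H * sqrt (real K) * (\<theta> * \<eta> / (1 + l * s))" by simp
  also have "\<dots> \<le> op_norm H * sqrt (real K) * max (M1 * M2) (inverse s * inverse c)"
  proof (rule mult_left_mono)
    show "\<theta> * \<eta> / (1 + l * s) \<le> max (M1 * M2) (inverse s * inverse c)"
      using \<eta> \<theta> \<open>M1 > 0\<close> by (intro le_max mult_mono) auto
  qed (simp add: op_norm_nonneg)
  finally show "norm (unobs_part CARD('q) (a k) - unobs_part CARD('q) (v k))
      \<le> op_norm H * sqrt (real K) * max (M1 * M2) (inverse (rho0 h) * inverse c)"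
    unfolding s_def .
qed

section \<open>Size of an analysis member in terms of signal, forecast and noises\<close>

lemma square_add3_le: "(a + b + c)\<^sup>2 \<le> 3 * (a\<^sup>2 + b\<^sup>2 + c\<^sup>2)" for a b c :: real
  using zero_le_power2[of "a - b"] zero_le_power2[of "a - c"] zero_le_power2[of "b - c"]
  by (simp add: power2_eq_square algebra_simps)

text \<open>Young's inequality. A small \<open>e\<close> keeps the coefficient of the first square
  close to 1 at the expense of the second.\<close>

lemma square_add_le_weighted:
  fixes a b e :: real
  assumes "e > 0"
  shows "(a + b)\<^sup>2 \<le> (1 + e) * a\<^sup>2 + (1 + 1 / e) * b\<^sup>2"
proof -
  have "0 \<le> (e * a - b)\<^sup>2 / e" using assms by simp
  also have "\<dots> = e * a\<^sup>2 - 2 * a * b + b\<^sup>2 / e"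
    using assms by (simp add: power2_eq_square field_simps)
  finally show ?thesis by (simp add: power2_eq_square algebra_simps)
qed

text \<open>The two blocks are treated with different care. The observed part may lose a factor 2,
  and \<open>6 = 2 * 3\<close> on the remaining terms, because its signal term is later absorbed by
  the weight in the energy. The unobserved part keeps the coefficient \<open>1 + e\<close> on the
  forecast, as nothing else compensates a loss there.\<close>

lemma norm_analysis_le:
  fixes v v' u :: "('d :: {finite, linorder}) rvec" and h x y :: "('q :: {finite, linorder}) rvec"
  defines "H \<equiv> (obs_matrix h :: ('q, 'd) rmat)"
  assumes dims: "CARD('q) \<le> CARD('d)" and h_pos: "\<And>i. h $ i > 0" and "e > 0"
    and obs: "norm (H *v v' - (H *v u + x + y)) \<le> A"
    and unobs: "norm (unobs_part CARD('q) v' - unobs_part CARD('q) v) \<le> B"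
  shows "(norm v')\<^sup>2 \<le> inverse (rho0 h) * (2 * (op_norm H)\<^sup>2 * (norm u)\<^sup>2
           + 6 * (A\<^sup>2 + (norm x)\<^sup>2 + (norm y)\<^sup>2))
         + (1 + e) * (norm v)\<^sup>2 + (1 + 1 / e) * B\<^sup>2"
proof -
  have s: "0 < rho0 h" using h_pos by (rule rho0_pos)
  define p where "p = H *v v' - (H *v u + x + y)"
  have "H *v v' = p + (H *v u + x + y)" by (simp only: p_def diff_add_cancel)
  then have eq: "H *v v' = H *v u + p + x + y" by (simp only: ac_simps)
  have "norm (H *v v') \<le> norm (H *v u) + (norm p + norm x + norm y)"
    unfolding eq
    using norm_triangle_ineq[of "H *v u + p + x" y] norm_triangle_ineq[of "H *v u + p" x]
      norm_triangle_ineq[of "H *v u" p] by linarith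
  also have "\<dots> \<le> op_norm H * norm u + (A + norm x + norm y)"
    using obs by (intro add_mono norm_mult_le_op_norm) (simp_all only: p_def order.refl)
  finally have "(norm (H *v v'))\<^sup>2 \<le> (op_norm H * norm u + (A + norm x + norm y))\<^sup>2"
    by (intro power_mono) auto
  also have "\<dots> \<le> 2 * (op_norm H * norm u)\<^sup>2 + 2 * (A + norm x + norm y)\<^sup>2"
    using square_add_le_weighted[of 1] by simp
  also have "\<dots> \<le> 2 * (op_norm H * norm u)\<^sup>2 + 2 * (3 * (A\<^sup>2 + (norm x)\<^sup>2 + (norm y)\<^sup>2))"
    by (intro add_left_mono mult_left_mono square_add3_le) simp
  finally have "(norm (H *v v'))\<^sup>2 \<le>
      2 * (op_norm H)\<^sup>2 * (norm u)\<^sup>2 + 6 * (A\<^sup>2 + (norm x)\<^sup>2 + (norm y)\<^sup>2)"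
    by (simp add: power_mult_distrib)
  moreover have "rho0 h * (norm (obs_part v' :: 'q rvec))\<^sup>2 \<le> (norm (H *v v'))\<^sup>2"
    unfolding H_def by (rule rho0_norm_le) (rule obs_matrix_mult_nth[OF dims])
  ultimately have X: "(norm (obs_part v' :: 'q rvec))\<^sup>2 \<le> inverse (rho0 h) *
      (2 * (op_norm H)\<^sup>2 * (norm u)\<^sup>2 + 6 * (A\<^sup>2 + (norm x)\<^sup>2 + (norm y)\<^sup>2))"
    using s by (simp add: field_simps)
  have "norm (unobs_part CARD('q) v') \<le> norm v + B"
    using norm_unobs_part_le[OF dims, of v] unobs norm_triangle_sub[of "unobs_part CARD('q) v'" "unobs_part CARD('q) v"] by linarith
  then have "(norm (unobs_part CARD('q) v'))\<^sup>2 \<le> (norm v + B)\<^sup>2" by (intro power_mono) auto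
  also have "\<dots> \<le> (1 + e) * (norm v)\<^sup>2 + (1 + 1 / e) * B\<^sup>2"
    using \<open>e > 0\<close> by (rule square_add_le_weighted)
  finally show ?thesis using X norm_obs_unobs[OF dims, of v'] by linarith
qed

section \<open>Measurability of the analysis step\<close>

lemma borel_measurable_vecI:
  fixes f :: "'a \<Rightarrow> 'b :: euclidean_space ^ 'n"
  assumes "\<And>i. (\<lambda>x. f x $ i) \<in> borel_measurable M"
  shows "f \<in> borel_measurable M"
  using assms by (subst borel_measurable_euclidean_space) (auto simp: Basis_vec_def inner_axis)

lemma borel_measurable_vec_nth:
  fixes f :: "'a \<Rightarrow> 'b :: euclidean_space ^ 'n"
  assumes "f \<in> borel_measurable M"
  shows "(\<lambda>x. f x $ i) \<in> borel_measurable M"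
  by (rule borel_measurable_continuous_on[OF _ assms, where f = "\<lambda>v. v $ i"])
     (intro linear_continuous_on bounded_linear_vec_nth)

lemma borel_measurable_matrix_vector_mult:
  fixes A :: "'a \<Rightarrow> real ^ 'n ^ 'm"
  assumes [measurable]: "A \<in> borel_measurable M" "f \<in> borel_measurable M"
  shows "(\<lambda>x. A x *v f x) \<in> borel_measurable M"
proof (rule borel_measurable_vecI)
  note [measurable (raw)] = borel_measurable_vec_nth
  show "(\<lambda>x. (A x *v f x) $ i) \<in> borel_measurable M" for i
    unfolding matrix_vector_mult_def vec_lambda_beta by measurable
qed

lemma borel_measurable_matrix_matrix_mult:
  fixes A :: "'a \<Rightarrow> real ^ 'n ^ 'm" and B :: "'a \<Rightarrow> real ^ 'p ^ 'n"
  assumes [measurable]: "A \<in> borel_measurable M" "B \<in> borel_measurable M"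
  shows "(\<lambda>x. A x ** B x) \<in> borel_measurable M"
proof (intro borel_measurable_vecI)
  note [measurable (raw)] = borel_measurable_vec_nth
  show "(\<lambda>x. (A x ** B x) $ i $ j) \<in> borel_measurable M" for i j
    unfolding matrix_matrix_mult_def vec_lambda_beta by measurable
qed

text \<open>The determinant is a polynomial in the entries.\<close>

lemma borel_measurable_det:
  fixes A :: "'a \<Rightarrow> real ^ 'n ^ 'n"
  assumes "\<And>i j. (\<lambda>x. A x $ i $ j) \<in> borel_measurable M"
  shows "(\<lambda>x. det (A x)) \<in> borel_measurable M"
  unfolding det_def using assms by measurable

text \<open>
  On singular matrices, \<open>matrix_inv\<close> has one fixed value; on the others it is given by Cramer's rule.
\<close>

lemma matrix_inv_eq_cramer:
  fixes A :: "real ^ 'n ^ 'n"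
  shows "matrix_inv A =
    (if det A = 0 then (SOME B. False)
     else (\<chi> k l. det (\<chi> i j. if j = k then axis l 1 $ i else A $ i $ j) / det A))"
proof (cases "det A = 0")
  case True
  then have "\<not> invertible A" by (simp add: invertible_det_nz)
  then have "(\<lambda>B. A ** B = mat 1 \<and> B ** A = mat 1) = (\<lambda>B. False)"
    unfolding invertible_def by auto
  then show ?thesis using True by (simp add: matrix_inv_def)
next
  case False
  then have "\<exists>B. A ** B = mat 1 \<and> B ** A = mat 1"
    using invertible_det_nz[of A] by (simp add: invertible_def)
  then have inv: "A ** matrix_inv A = mat 1"
    unfolding matrix_inv_def by (rule someI2_ex) simp
  have "matrix_inv A $ k $ l = det (\<chi> i j. if j = k then axis l 1 $ i else A $ i $ j) / det A" for k l
  proof -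
    \<comment> \<open>Column \<open>l\<close> of the inverse solves the linear system with
      right-hand side \<open>axis l 1\<close>; Cramer's rule gives its entries.\<close>
    have "A *v (matrix_inv A *v axis l 1) = axis l 1"
      by (simp add: matrix_vector_mul_assoc inv)
    then have "matrix_inv A *v axis l 1 =
        (\<chi> k. det (\<chi> i j. if j = k then axis l 1 $ i else A $ i $ j) / det A)"
      using cramer[OF False] by blast
    moreover have "(matrix_inv A *v axis l 1) $ k = matrix_inv A $ k $ l"
      by (simp add: matrix_vector_mul_component inner_axis)
    ultimately show ?thesis by simp
  qed
  then show ?thesis using False by (simp add: vec_eq_iff)
qed

lemma borel_measurable_matrix_inv:
  fixes A :: "'a \<Rightarrow> real ^ 'n ^ 'n"
  assumes [measurable]: "A \<in> borel_measurable M"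
  shows "(\<lambda>x. matrix_inv (A x)) \<in> borel_measurable M"
proof -
  note [measurable (raw)] = borel_measurable_vec_nth
  have [measurable]: "(\<lambda>x. det (A x)) \<in> borel_measurable M"
    by (rule borel_measurable_det) measurable
  have "(\<lambda>x. det (\<chi> i j. if j = k then axis l 1 $ i else A x $ i $ j)) \<in> borel_measurable M" for k l
  proof (rule borel_measurable_det)
    show "(\<lambda>x. (\<chi> i j. if j = k then axis l 1 $ i else A x $ i $ j) $ i $ j) \<in> borel_measurable M"
      for i j by (cases "j = k") auto
  qed
  then have [measurable]: "(\<lambda>x. \<chi> k l. det (\<chi> i j. if j = k then axis l 1 $ i else A x $ i $ j) / det (A x))
      \<in> borel_measurable M"
    by (intro borel_measurable_vecI) simp
  show ?thesis unfolding matrix_inv_eq_cramer by measurable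
qed

lemma borel_measurable_ens_cov:
  fixes x :: "nat \<Rightarrow> 'a \<Rightarrow> real ^ 'm" and y :: "nat \<Rightarrow> 'a \<Rightarrow> real ^ 'n"
  assumes x: "\<And>k. k \<in> {1..K} \<Longrightarrow> x k \<in> borel_measurable M"
    and y: "\<And>k. k \<in> {1..K} \<Longrightarrow> y k \<in> borel_measurable M"
  shows "(\<lambda>\<omega>. ens_cov K (\<lambda>k. x k \<omega>) (\<lambda>k. y k \<omega>)) \<in> borel_measurable M"
proof (intro borel_measurable_vecI)
  fix i j
  have [measurable]: "(\<lambda>\<omega>. ens_mean K (\<lambda>k. x k \<omega>)) \<in> borel_measurable M"
      "(\<lambda>\<omega>. ens_mean K (\<lambda>k. y k \<omega>)) \<in> borel_measurable M"
    unfolding ens_mean_def by (intro borel_measurable_scaleR borel_measurable_sum x y; simp)+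
  have "(\<lambda>\<omega>. 1 / (real K - 1) * (\<Sum>k = 1..K. (x k \<omega> - ens_mean K (\<lambda>k. x k \<omega>)) $ i *
        (y k \<omega> - ens_mean K (\<lambda>k. y k \<omega>)) $ j)) \<in> borel_measurable M"
    by (intro borel_measurable_times borel_measurable_sum borel_measurable_const
        borel_measurable_vec_nth borel_measurable_diff x y; measurable)
  then show "(\<lambda>\<omega>. ens_cov K (\<lambda>k. x k \<omega>) (\<lambda>k. y k \<omega>) $ i $ j) \<in> borel_measurable M"
    by (simp add: ens_cov_def tensor_def sum_component)
qed

text \<open>The inflation strength is itself random, so the matrix to be inverted varies with the
  outcome and measurability of \<open>matrix_inv\<close> is required.\<close>

lemma borel_measurable_analysis:
  fixes v :: "nat \<Rightarrow> 'a \<Rightarrow> real ^ 'd" and z :: "'a \<Rightarrow> real ^ 'q"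
  assumes v: "\<And>k. k \<in> {1..K} \<Longrightarrow> v k \<in> borel_measurable M" and "k \<in> {1..K}"
    and [measurable]: "l \<in> borel_measurable M" "z \<in> borel_measurable M"
  shows "(\<lambda>\<omega>. analysis H (inflated_cov K (l \<omega>) (\<lambda>j. v j \<omega>)) (v k \<omega>) (z \<omega>)) \<in> borel_measurable M"
proof -
  note [measurable (raw)] = borel_measurable_matrix_vector_mult borel_measurable_matrix_matrix_mult
    borel_measurable_matrix_inv
  have [measurable]: "v k \<in> borel_measurable M" by (rule v) fact
  have [measurable]: "(\<lambda>\<omega>. ens_cov K (\<lambda>j. v j \<omega>) (\<lambda>j. v j \<omega>)) \<in> borel_measurable M"
    by (rule borel_measurable_ens_cov) (auto intro: v)
  show ?thesis unfolding analysis_def inflated_cov_def by measurable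
qed

section \<open>Conditional laws and second moments\<close>

text \<open>The hypothesis \<open>law\<close> speaks only of events \<open>Y \<in> B\<close>. For
  each \<open>A\<close> in \<open>F\<close> it determines the law of the pair \<open>(X, Y)\<close>
  on \<open>A\<close>: on rectangles because the condition on \<open>X\<close> can be pulled out of
  the conditional expectation, and then everywhere because rectangles form an intersection-stable
  generator.\<close>

lemma nn_cond_exp_disintegration:
  fixes X :: "'w \<Rightarrow> 'a" and Y :: "'w \<Rightarrow> 'b" and f :: "'a \<times> 'b \<Rightarrow> ennreal"
  assumes "prob_space M" and sub: "subalgebra M F"
    and X: "X \<in> F \<rightarrow>\<^sub>M N" and Y[measurable]: "Y \<in> M \<rightarrow>\<^sub>M L"
    and \<kappa>: "\<kappa> \<in> N \<rightarrow>\<^sub>M prob_algebra L"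
    and law: "\<And>B. B \<in> sets L \<Longrightarrow> AE \<omega> in M.
      real_cond_exp M F (indicator {\<omega> \<in> space M. Y \<omega> \<in> B}) \<omega> = measure (\<kappa> (X \<omega>)) B"
    and f[measurable]: "f \<in> borel_measurable (N \<Otimes>\<^sub>M L)"
  shows "AE \<omega> in M. (\<integral>\<^sup>+y. f (X \<omega>, y) \<partial>\<kappa> (X \<omega>)) = nn_cond_exp M F (\<lambda>\<omega>. f (X \<omega>, Y \<omega>)) \<omega>"
proof -
  interpret prob_space M by fact
  interpret finite_measure_subalgebra M F by unfold_locales (rule sub)
  note X[measurable] have XM[measurable]: "X \<in> M \<rightarrow>\<^sub>M N" using sub X by (rule measurable_from_subalg)
  have \<kappa>'[measurable]: "\<kappa> \<in> N \<rightarrow>\<^sub>M subprob_algebra L" using \<kappa> by (rule measurable_prob_algebraD)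
  have \<kappa>_prob: "prob_space (\<kappa> (X \<omega>))" "sets (\<kappa> (X \<omega>)) = sets L" if "\<omega> \<in> space M" for \<omega>
    using measurable_space[OF \<kappa> measurable_space[OF XM that]] by (auto simp: space_prob_algebra)
  have Pair[measurable]: "Pair (X \<omega>) \<in> \<kappa> (X \<omega>) \<rightarrow>\<^sub>M N \<Otimes>\<^sub>M L" if "\<omega> \<in> space M" for \<omega>
    using measurable_Pair1'[OF measurable_space[OF XM that]] \<kappa>_prob(2)[OF that]
    by (simp cong: measurable_cong_sets)
  have joint[measurable]: "(\<lambda>\<omega>. distr (\<kappa> (X \<omega>)) (N \<Otimes>\<^sub>M L) (Pair (X \<omega>))) \<in> M \<rightarrow>\<^sub>M subprob_algebra (N \<Otimes>\<^sub>M L)"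
    by (rule measurable_distr2[where M = L]) measurable
  show ?thesis
  proof (rule nn_cond_exp_charact)
    show "(\<lambda>\<omega>. f (X \<omega>, Y \<omega>)) \<in> borel_measurable M" by measurable
    show "(\<lambda>\<omega>. \<integral>\<^sup>+y. f (X \<omega>, y) \<partial>\<kappa> (X \<omega>)) \<in> borel_measurable F"
      by (rule nn_integral_measurable_subprob_algebra2[where N = L]) measurable
    fix A assume A[measurable]: "A \<in> sets F"
    have AM[measurable]: "A \<in> sets M" using A sub by (auto simp: subalgebra_def)
    \<comment> \<open>\<open>?D\<close> is \<open>M\<close> restricted to \<open>A\<close>.
      \<open>?N1\<close> is the law of \<open>(X, Y)\<close> under it, while \<open>?N2\<close>
      keeps \<open>X\<close> and draws the second component from
      \<open>\<kappa> (X \<omega>)\<close>.\<close>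
    let ?D = "density M (indicator A)"
    let ?N1 = "distr ?D (N \<Otimes>\<^sub>M L) (\<lambda>\<omega>. (X \<omega>, Y \<omega>))"
    let ?N2 = "?D \<bind> (\<lambda>\<omega>. distr (\<kappa> (X \<omega>)) (N \<Otimes>\<^sub>M L) (Pair (X \<omega>)))"
    have joint'[measurable]: "(\<lambda>\<omega>. distr (\<kappa> (X \<omega>)) (N \<Otimes>\<^sub>M L) (Pair (X \<omega>))) \<in> ?D \<rightarrow>\<^sub>M subprob_algebra (N \<Otimes>\<^sub>M L)"
      using joint by simp
    have rect: "emeasure ?N1 (C \<times> B) = emeasure ?N2 (C \<times> B)"
      if [measurable]: "C \<in> sets N" "B \<in> sets L" for C B
    proof -
      let ?I = "\<lambda>\<omega>. indicator A \<omega> * indicator C (X \<omega>) :: real"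
      let ?J = "indicator {\<omega> \<in> space M. Y \<omega> \<in> B} :: 'w \<Rightarrow> real"
      have int: "integrable M (\<lambda>\<omega>. ?I \<omega> * ?J \<omega>)"
        by (rule integrable_const_bound[where B = 1]) (auto simp: indicator_def)
      have mY: "?J \<in> borel_measurable M" by measurable
      have mI: "?I \<in> borel_measurable F" by measurable
      \<comment> \<open>\<open>?I\<close> is measurable with respect to \<open>F\<close>, so
        multiplying by it allows the conditional probability to be exchanged for the indicator
        \<open>?J\<close>.\<close>
      have int_eq: "(\<integral>\<omega>. ?I \<omega> * measure (\<kappa> (X \<omega>)) B \<partial>M) = (\<integral>\<omega>. ?I \<omega> * ?J \<omega> \<partial>M)"
      proof -
        have "(\<integral>\<omega>. ?I \<omega> * measure (\<kappa> (X \<omega>)) B \<partial>M) = (\<integral>\<omega>. ?I \<omega> * real_cond_exp M F ?J \<omega> \<partial>M)"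
          using law[OF \<open>B \<in> sets L\<close>] by (intro integral_cong_AE) auto
        also have "\<dots> = (\<integral>\<omega>. ?I \<omega> * ?J \<omega> \<partial>M)"
          by (rule real_cond_exp_intg(2)[OF int mI mY])
        finally show ?thesis .
      qed
      have int': "integrable M (\<lambda>\<omega>. ?I \<omega> * measure (\<kappa> (X \<omega>)) B)"
      proof (rule integrable_const_bound[where B = 1])
        show "AE \<omega> in M. norm (?I \<omega> * measure (\<kappa> (X \<omega>)) B) \<le> 1"
          using prob_space.prob_le_1[OF \<kappa>_prob(1)] by (auto simp: indicator_def)
      qed measurable
      have "emeasure ?N1 (C \<times> B) = (\<integral>\<^sup>+\<omega>. indicator A \<omega> * indicator ((\<lambda>\<omega>. (X \<omega>, Y \<omega>)) -` (C \<times> B) \<inter> space M) \<omega> \<partial>M)"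
        by (subst emeasure_distr) (auto simp: emeasure_density)
      also have "\<dots> = (\<integral>\<^sup>+\<omega>. ennreal (?I \<omega> * ?J \<omega>) \<partial>M)"
        by (rule nn_integral_cong) (auto simp: indicator_def)
      also have "\<dots> = ennreal (\<integral>\<omega>. ?I \<omega> * ?J \<omega> \<partial>M)"
        by (rule nn_integral_eq_integral[OF int]) auto
      also have "\<dots> = ennreal (\<integral>\<omega>. ?I \<omega> * measure (\<kappa> (X \<omega>)) B \<partial>M)" by (simp only: int_eq)
      also have "\<dots> = (\<integral>\<^sup>+\<omega>. ennreal (?I \<omega> * measure (\<kappa> (X \<omega>)) B) \<partial>M)"
        by (rule nn_integral_eq_integral[OF int', symmetric]) auto
      also have "\<dots> = (\<integral>\<^sup>+\<omega>. indicator A \<omega> * emeasure (distr (\<kappa> (X \<omega>)) (N \<Otimes>\<^sub>M L) (Pair (X \<omega>))) (C \<times> B) \<partial>M)"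
      proof (rule nn_integral_cong)
        fix \<omega> assume \<omega>: "\<omega> \<in> space M"
        interpret \<kappa>: prob_space "\<kappa> (X \<omega>)" by (rule \<kappa>_prob[OF \<omega>])
        have "Pair (X \<omega>) -` (C \<times> B) \<inter> space (\<kappa> (X \<omega>)) = (if X \<omega> \<in> C then B else {})"
          using sets.sets_into_space[OF \<open>B \<in> sets L\<close>] sets_eq_imp_space_eq[OF \<kappa>_prob(2)[OF \<omega>]] by auto
        then have "emeasure (distr (\<kappa> (X \<omega>)) (N \<Otimes>\<^sub>M L) (Pair (X \<omega>))) (C \<times> B) =
            indicator C (X \<omega>) * ennreal (measure (\<kappa> (X \<omega>)) B)"
          using Pair[OF \<omega>] by (subst emeasure_distr) (auto simp: \<kappa>.emeasure_eq_measure)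
        then show "ennreal (?I \<omega> * measure (\<kappa> (X \<omega>)) B) =
            indicator A \<omega> * emeasure (distr (\<kappa> (X \<omega>)) (N \<Otimes>\<^sub>M L) (Pair (X \<omega>))) (C \<times> B)"
          by (auto simp: indicator_def)
      qed
      also have "\<dots> = (\<integral>\<^sup>+\<omega>. emeasure (distr (\<kappa> (X \<omega>)) (N \<Otimes>\<^sub>M L) (Pair (X \<omega>))) (C \<times> B) \<partial>?D)"
        by (rule nn_integral_density[symmetric])
           (use measurable_emeasure_subprob_algebra joint in measurable)
      also have "\<dots> = emeasure ?N2 (C \<times> B)"
        by (rule emeasure_bind[OF _ joint', symmetric]) (auto simp: not_empty)
      finally show ?thesis .
    qed
    have eq: "?N1 = ?N2"
    proof (rule measure_eqI_generator_eq[OF Int_stable_pair_measure_generator[of N L]])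
      show "{a \<times> b |a b. a \<in> sets N \<and> b \<in> sets L} \<subseteq> Pow (space N \<times> space L)"
        by (rule pair_measure_closed)
      show "sets ?N1 = sigma_sets (space N \<times> space L) {a \<times> b |a b. a \<in> sets N \<and> b \<in> sets L}"
        by (simp add: sets_pair_measure)
      show "sets ?N2 = sigma_sets (space N \<times> space L) {a \<times> b |a b. a \<in> sets N \<and> b \<in> sets L}"
        by (subst sets_bind[where N = "N \<Otimes>\<^sub>M L"]) (auto simp: sets_pair_measure not_empty)
      show "range (\<lambda>_. space N \<times> space L) \<subseteq> {a \<times> b |a b. a \<in> sets N \<and> b \<in> sets L}" by auto
      show "emeasure ?N1 (space N \<times> space L) \<noteq> \<infinity>"
      proof -
        have "emeasure ?N1 (space N \<times> space L) \<le> emeasure ?D (space M)"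
          by (subst emeasure_distr) (auto intro!: emeasure_mono)
        also have "\<dots> = emeasure M A" by (simp add: emeasure_density nn_integral_indicator cong: nn_integral_cong)
        also have "\<dots> < \<infinity>" by (simp add: less_top[symmetric])
        finally show ?thesis by simp
      qed
    qed (use rect in auto)
    \<comment> \<open>The integral of \<open>f\<close> against the common measure, evaluated through
      either description, is the identity on \<open>A\<close> that characterises the conditional
      expectation.\<close>
    have "(\<integral>\<^sup>+\<omega>\<in>A. f (X \<omega>, Y \<omega>) \<partial>M) = (\<integral>\<^sup>+p. f p \<partial>?N1)"
      by (simp add: nn_integral_distr nn_integral_density mult.commute)
    also have "\<dots> = (\<integral>\<^sup>+p. f p \<partial>?N2)" by (simp only: eq)
    also have "\<dots> = (\<integral>\<^sup>+\<omega>. \<integral>\<^sup>+p. f p \<partial>distr (\<kappa> (X \<omega>)) (N \<Otimes>\<^sub>M L) (Pair (X \<omega>)) \<partial>?D)"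
      by (rule nn_integral_bind[OF f joint'])
    also have "\<dots> = (\<integral>\<^sup>+\<omega>. \<integral>\<^sup>+y. f (X \<omega>, y) \<partial>\<kappa> (X \<omega>) \<partial>?D)"
      by (intro nn_integral_cong) (simp add: nn_integral_distr[OF Pair])
    also have "\<dots> = (\<integral>\<^sup>+\<omega>. indicator A \<omega> * (\<integral>\<^sup>+y. f (X \<omega>, y) \<partial>\<kappa> (X \<omega>)) \<partial>M)"
      by (rule nn_integral_density)
         (auto intro!: nn_integral_measurable_subprob_algebra2[where N = L])
    finally show "(\<integral>\<^sup>+\<omega>\<in>A. f (X \<omega>, Y \<omega>) \<partial>M) = (\<integral>\<^sup>+\<omega>\<in>A. (\<integral>\<^sup>+y. f (X \<omega>, y) \<partial>\<kappa> (X \<omega>)) \<partial>M)"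
      by (simp add: mult.commute)
  qed
qed

section \<open>Second moments of the Gaussian and of the model noise\<close>

lemma nn_integral_lborel_vec_prod:
  fixes f :: "'q :: finite \<Rightarrow> real \<Rightarrow> ennreal"
  assumes "\<And>i. f i \<in> borel_measurable borel"
  shows "(\<integral>\<^sup>+x. (\<Prod>i\<in>UNIV. f i (x $ i)) \<partial>(lborel :: (real ^ 'q) measure)) = (\<Prod>i\<in>UNIV. \<integral>\<^sup>+t. f i t \<partial>lborel)"
proof -
  have Basis: "(Basis :: (real ^ 'q) set) = range (\<lambda>i. axis i 1)" by (auto simp: Basis_vec_def)
  have inj: "inj (\<lambda>i. axis i 1 :: real ^ 'q)" by (auto simp: inj_on_def axis_eq_axis)
  have prod: "(\<Prod>b\<in>(Basis :: (real ^ 'q) set). g b) = (\<Prod>i\<in>UNIV. g (axis i 1))" for g :: "_ \<Rightarrow> ennreal"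
    unfolding Basis by (simp add: prod.reindex[OF inj])
  show ?thesis
    using nn_integral_lborel_prod[where f = "\<lambda>b :: real ^ 'q. f (axis_index b)"] assms
    by (simp add: prod inner_axis)
qed

text \<open>The density is a product over the coordinates, so it is absorbed into the factors before
  the product formula for Lebesgue measure is applied.\<close>

lemma nn_integral_std_gaussian_prod:
  fixes f :: "'q :: finite \<Rightarrow> real \<Rightarrow> ennreal"
  assumes [measurable]: "\<And>i. f i \<in> borel_measurable borel"
  shows "(\<integral>\<^sup>+x. (\<Prod>i\<in>UNIV. f i (x $ i)) \<partial>(std_gaussian :: (real ^ 'q) measure)) =
    (\<Prod>i\<in>UNIV. \<integral>\<^sup>+t. ennreal (std_normal_density t) * f i t \<partial>lborel)"
proof -
  have "(\<integral>\<^sup>+x. (\<Prod>i\<in>UNIV. f i (x $ i)) \<partial>(std_gaussian :: (real ^ 'q) measure)) =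
    (\<integral>\<^sup>+x. (\<Prod>i\<in>UNIV. ennreal (std_normal_density (x $ i)) * f i (x $ i)) \<partial>(lborel :: (real ^ 'q) measure))"
    unfolding std_gaussian_def
    by (subst nn_integral_density) (simp_all add: prod_ennreal prod.distrib)
  also have "\<dots> = (\<Prod>i\<in>UNIV. \<integral>\<^sup>+t. ennreal (std_normal_density t) * f i t \<partial>lborel)"
    by (rule nn_integral_lborel_vec_prod[where f = "\<lambda>i t. ennreal (std_normal_density t) * f i t"]) measurable
  finally show ?thesis .
qed

lemma nn_integral_std_normal_density: "(\<integral>\<^sup>+t. ennreal (std_normal_density t) \<partial>lborel) = 1"
  using std_normal_moment_even[of 0]
  by (subst nn_integral_eq_integral) (auto simp: has_bochner_integral_iff)

lemma nn_integral_std_normal_density_square: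
  "(\<integral>\<^sup>+t. ennreal (std_normal_density t) * ennreal (t\<^sup>2) \<partial>lborel) = 1"
  unfolding ennreal_mult[OF normal_density_nonneg zero_le_power2, symmetric]
  using std_normal_moment_even[of 1]
  by (subst nn_integral_eq_integral) (auto simp: has_bochner_integral_iff)

lemma std_gaussian_in_prob_algebra: "std_gaussian \<in> space (prob_algebra borel)"
proof -
  have "emeasure std_gaussian (space std_gaussian) = 1"
    using nn_integral_std_gaussian_prod[of "\<lambda>_ _. 1"]
    by (simp add: nn_integral_std_normal_density)
  then show ?thesis
    by (auto simp: space_prob_algebra std_gaussian_def intro: prob_spaceI)
qed

lemma nn_integral_std_gaussian_norm_square:
  "(\<integral>\<^sup>+x. ennreal ((norm x)\<^sup>2) \<partial>(std_gaussian :: (real ^ 'q) measure)) = of_nat CARD('q :: finite)"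
proof -
  have coord: "(\<integral>\<^sup>+x. ennreal ((x $ i)\<^sup>2) \<partial>(std_gaussian :: (real ^ 'q) measure)) = 1" for i
  proof -
    \<comment> \<open>A function of one coordinate is written as a product with all other factors
      equal to 1, so that each coordinate contributes a zeroth or second moment, both equal to
      1.\<close>
    have "(\<integral>\<^sup>+x. ennreal ((x $ i)\<^sup>2) \<partial>(std_gaussian :: (real ^ 'q) measure)) =
      (\<integral>\<^sup>+x. (\<Prod>j\<in>UNIV. if j = i then ennreal ((x $ j)\<^sup>2) else 1) \<partial>(std_gaussian :: (real ^ 'q) measure))"
      by (simp add: prod.delta)
    also have "\<dots> = (\<Prod>j\<in>UNIV. \<integral>\<^sup>+t. ennreal (std_normal_density t) *
        (if j = i then ennreal (t\<^sup>2) else 1) \<partial>lborel)"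
      by (rule nn_integral_std_gaussian_prod[where f = "\<lambda>j t. if j = i then ennreal (t\<^sup>2) else 1"]) measurable
    also have "\<dots> = 1"
    proof (rule prod.neutral, rule ballI)
      fix j show "(\<integral>\<^sup>+t. ennreal (std_normal_density t) * (if j = i then ennreal (t\<^sup>2) else 1) \<partial>lborel) = 1"
        by (cases "j = i") (simp_all add: nn_integral_std_normal_density nn_integral_std_normal_density_square)
    qed
    finally show ?thesis .
  qed
  have "(\<integral>\<^sup>+x. ennreal ((norm x)\<^sup>2) \<partial>(std_gaussian :: (real ^ 'q) measure)) =
      (\<integral>\<^sup>+x. (\<Sum>i\<in>UNIV. ennreal ((x $ i)\<^sup>2)) \<partial>(std_gaussian :: (real ^ 'q) measure))"
    by (simp add: power2_norm_eq_inner inner_vec_def power2_eq_square[symmetric] sum_ennreal)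
  also have "\<dots> = of_nat CARD('q)"
    by (subst nn_integral_sum) (simp_all add: coord, simp add: std_gaussian_def)
  finally show ?thesis .
qed

text \<open>The trace is the sum of the coordinate second moments. Each of them is dominated by
  \<open>|z|^2\<close>, and this integrability is what allows sum and Bochner integral to be
  exchanged.\<close>

lemma trace_noise_cov:
  fixes u :: "real ^ 'd"
  assumes int: "integrable (\<kappa> u) (\<lambda>z. (norm z)\<^sup>2)" and sets: "sets (\<kappa> u) = sets borel"
  shows "trace (noise_cov \<kappa> u) = (\<integral>z. (norm z)\<^sup>2 \<partial>\<kappa> u)"
proof -
  have "integrable (\<kappa> u) (\<lambda>z. (z $ i)\<^sup>2)" for i
  proof (rule Bochner_Integration.integrable_bound[OF int])
    have "(z $ i)\<^sup>2 \<le> (norm z)\<^sup>2" for z :: "real ^ 'd"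
      using power_mono[OF component_le_norm_cart[of z i], of 2] by simp
    then show "AE z in \<kappa> u. norm ((z $ i)\<^sup>2) \<le> norm ((norm z)\<^sup>2)" by simp
  qed (simp add: sets cong: measurable_cong_sets)
  moreover have "(norm z)\<^sup>2 = (\<Sum>i\<in>UNIV. (z $ i)\<^sup>2)" for z :: "real ^ 'd"
    unfolding power2_norm_eq_inner inner_vec_def by (simp add: power2_eq_square)
  ultimately show ?thesis
    by (simp add: trace_def noise_cov_def tensor_def flip: power2_eq_square)
qed

text \<open>The cross term vanishes since the mean is zero; it is integrable because
  \<open>|z| \<le> 1 + |z|^2\<close>. With \<open>a = \<Psi> u\<close> and the noise law at
  \<open>u\<close>, the right-hand side is the quantity bounded by the energy principle.\<close>

lemma nn_integral_norm_add_square: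
  fixes a :: "real ^ 'd"
  assumes "prob_space \<nu>" and sets: "sets \<nu> = sets borel"
    and int: "integrable \<nu> (\<lambda>z. (norm z)\<^sup>2)" and mean: "(\<integral>z. z \<partial>\<nu>) = 0"
  shows "(\<integral>\<^sup>+z. ennreal ((norm (a + z))\<^sup>2) \<partial>\<nu>) = ennreal ((norm a)\<^sup>2 + (\<integral>z. (norm z)\<^sup>2 \<partial>\<nu>))"
proof -
  interpret prob_space \<nu> by fact
  have meas: "(\<lambda>z. z) \<in> borel_measurable \<nu>" by (simp add: sets cong: measurable_cong_sets)
  have id: "integrable \<nu> (\<lambda>z. z)"
  proof (rule Bochner_Integration.integrable_bound)
    show "integrable \<nu> (\<lambda>z. 1 + (norm z)\<^sup>2)" using int by simp
    have "norm z \<le> 1 + (norm z)\<^sup>2" for z :: "real ^ 'd"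
      using zero_le_power2[of "norm z - 1"] by (simp add: power2_diff) (smt (verit) zero_le_power2)
    then show "AE z in \<nu>. norm z \<le> norm (1 + (norm z)\<^sup>2)" by simp
  qed (rule meas)
  have expand: "(norm (a + z))\<^sup>2 = (norm a)\<^sup>2 + 2 * (a \<bullet> z) + (norm z)\<^sup>2" for z
    by (simp add: power2_norm_eq_inner inner_add_left inner_add_right inner_commute)
  have int': "integrable \<nu> (\<lambda>z. (norm (a + z))\<^sup>2)"
    unfolding expand using int id by (intro Bochner_Integration.integrable_add) auto
  have "(\<integral>\<^sup>+z. ennreal ((norm (a + z))\<^sup>2) \<partial>\<nu>) = ennreal (\<integral>z. (norm (a + z))\<^sup>2 \<partial>\<nu>)"
    by (rule nn_integral_eq_integral[OF int']) simp
  also have "(\<integral>z. (norm (a + z))\<^sup>2 \<partial>\<nu>) = (norm a)\<^sup>2 + (\<integral>z. (norm z)\<^sup>2 \<partial>\<nu>)"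
    unfolding expand using int id mean
    by (simp add: integral_inner_right Bochner_Integration.integral_add prob_space)
  finally show ?thesis .
qed

context sigma_finite_subalgebra
begin

text \<open>Here and in the next two lemmas an explicit version \<open>f'\<close> of the conditional
  expectation is carried along, so that versions for single terms assemble into one for a whole
  sum.\<close>

lemma nn_cond_exp_eq_add:
  assumes [measurable]: "f \<in> borel_measurable M" "g \<in> borel_measurable M"
    and "AE x in M. f' x = nn_cond_exp M F f x" "AE x in M. g' x = nn_cond_exp M F g x"
  shows "AE x in M. f' x + g' x = nn_cond_exp M F (\<lambda>x. f x + g x) x"
  using nn_cond_exp_sum[OF assms(1,2)] assms(3,4) by eventually_elim simp

lemma nn_cond_exp_eq_cmult:
  assumes [measurable]: "f \<in> borel_measurable M" and "AE x in M. f' x = nn_cond_exp M F f x"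
  shows "AE x in M. c * f' x = nn_cond_exp M F (\<lambda>x. c * f x) x"
  using nn_cond_exp_prod[of "\<lambda>_. c" f, simplified] assms(2) by eventually_elim simp

lemma nn_cond_exp_eq_sum:
  assumes "\<And>i. i \<in> I \<Longrightarrow> f i \<in> borel_measurable M"
    and "\<And>i. i \<in> I \<Longrightarrow> AE x in M. f' i x = nn_cond_exp M F (f i) x"
  shows "AE x in M. (\<Sum>i\<in>I. f' i x) = nn_cond_exp M F (\<lambda>x. \<Sum>i\<in>I. f i x) x"
  using assms
proof (induction I rule: infinite_finite_induct)
  case (insert i I)
  then show ?case
    using nn_cond_exp_eq_add[of "f i" "\<lambda>x. \<Sum>i\<in>I. f i x" "f' i" "\<lambda>x. \<Sum>i\<in>I. f' i x"] by simp
qed (use nn_cond_exp_F_meas[of "\<lambda>_. 0"] in simp_all)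

end

section \<open>Adapted states and conditional laws of the noises\<close>

lemma measurable_sigma_events_of:
  assumes "events_of M X \<subseteq> S" "S \<subseteq> Pow (space M)"
  shows "X \<in> sigma (space M) S \<rightarrow>\<^sub>M borel"
  using assms by (intro measurableI) (auto simp: events_of_def space_measure_of)

lemma events_of_subset_sets: "X \<in> N \<rightarrow>\<^sub>M borel \<Longrightarrow> space N = space M \<Longrightarrow> events_of M X \<subseteq> sets N"
  unfolding events_of_def using measurable_sets[of X N borel] by auto

text \<open>Ensembles are functions on all naturals, but the forecast equation holds only for
  indices in \<open>{1..K}\<close>; this allows it to be substituted inside the covariance.\<close>

lemma ens_cov_cong:
  assumes "\<And>k. k \<in> {1..K} \<Longrightarrow> x k = x' k" "\<And>k. k \<in> {1..K} \<Longrightarrow> y k = y' k"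
  shows "ens_cov K x y = ens_cov K x' y'"
proof -
  have "ens_mean K x = ens_mean K x'" "ens_mean K y = ens_mean K y'"
    using assms by (simp_all add: ens_mean_def cong: sum.cong_simp)
  then show ?thesis using assms by (simp add: ens_cov_def cong: sum.cong_simp)
qed

context enkf_ai
begin

abbreviation (input) "\<G> \<equiv> noise_filtration M K U V \<zeta> \<xi> \<zeta>e \<xi>e"
abbreviation (input) "\<F> \<equiv> state_filtration M K U V"

lemma noise_filtration_generators:
  "events_of M (U 0) \<union> (\<Union>k\<in>{1..K}. events_of M (V 0 k)) \<union>
      (\<Union>m\<in>{1..n}. events_of M (\<zeta> m) \<union> events_of M (\<xi> m) \<union>
         (\<Union>k\<in>{1..K}. events_of M (\<zeta>e m k) \<union> events_of M (\<xi>e m k))) \<subseteq> Pow (space M)"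
  by (auto simp: events_of_def)

lemma space_noise_filtration: "space (\<G> n) = space M"
  unfolding noise_filtration_def by (rule space_measure_of) (rule noise_filtration_generators)

lemma subalgebra_noise_filtration: "subalgebra M (\<G> n)"
proof -
  have noise: "\<zeta> m \<in> M \<rightarrow>\<^sub>M borel" "\<xi> m \<in> M \<rightarrow>\<^sub>M borel"
      "k \<in> {1..K} \<Longrightarrow> \<zeta>e m k \<in> M \<rightarrow>\<^sub>M borel" "k \<in> {1..K} \<Longrightarrow> \<xi>e m k \<in> M \<rightarrow>\<^sub>M borel"
    if "m \<in> {1..n}" for m k
  proof -
    have "m \<noteq> 0" using that by simp
    then obtain m' where "m = Suc m'" by (metis not0_implies_Suc)
    then show "\<zeta> m \<in> M \<rightarrow>\<^sub>M borel" "\<xi> m \<in> M \<rightarrow>\<^sub>M borel"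
      "k \<in> {1..K} \<Longrightarrow> \<zeta>e m k \<in> M \<rightarrow>\<^sub>M borel" "k \<in> {1..K} \<Longrightarrow> \<xi>e m k \<in> M \<rightarrow>\<^sub>M borel"
      using noise_measurable by blast+
  qed
  have "events_of M (U 0) \<union> (\<Union>k\<in>{1..K}. events_of M (V 0 k)) \<union>
      (\<Union>m\<in>{1..n}. events_of M (\<zeta> m) \<union> events_of M (\<xi> m) \<union>
         (\<Union>k\<in>{1..K}. events_of M (\<zeta>e m k) \<union> events_of M (\<xi>e m k))) \<subseteq> sets M"
    by (intro Un_least UN_least events_of_subset_sets init_measurable noise refl)
  then show ?thesis
    unfolding subalgebra_def space_noise_filtration
    unfolding noise_filtration_def sets_measure_of[OF noise_filtration_generators]
    by (simp add: sets.sigma_sets_subset)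
qed

lemma noise_filtration_mono: "m \<le> n \<Longrightarrow> subalgebra (\<G> n) (\<G> m)"
  unfolding subalgebra_def space_noise_filtration
  unfolding noise_filtration_def sets_measure_of[OF noise_filtration_generators]
  by (intro conjI refl sigma_sets_mono') fastforce

lemma measurable_noise_filtration:
  "U 0 \<in> \<G> n \<rightarrow>\<^sub>M borel"
  "k \<in> {1..K} \<Longrightarrow> V 0 k \<in> \<G> n \<rightarrow>\<^sub>M borel"
  "m \<in> {1..n} \<Longrightarrow> \<zeta> m \<in> \<G> n \<rightarrow>\<^sub>M borel"
  "m \<in> {1..n} \<Longrightarrow> \<xi> m \<in> \<G> n \<rightarrow>\<^sub>M borel"
  "m \<in> {1..n} \<Longrightarrow> k \<in> {1..K} \<Longrightarrow> \<zeta>e m k \<in> \<G> n \<rightarrow>\<^sub>M borel"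
  "m \<in> {1..n} \<Longrightarrow> k \<in> {1..K} \<Longrightarrow> \<xi>e m k \<in> \<G> n \<rightarrow>\<^sub>M borel"
  unfolding noise_filtration_def
  by (rule measurable_sigma_events_of[OF _ noise_filtration_generators]; blast)+

text \<open>Forecast and observations are eliminated, so that the new state becomes a function of
  the old one, the noises of this step and \<open>lam (Suc n)\<close>, all measurable at time
  \<open>Suc n\<close>.\<close>

lemma measurable_state_step:
  assumes U: "U n \<in> \<G> n \<rightarrow>\<^sub>M borel" and V: "\<And>k. k \<in> {1..K} \<Longrightarrow> V n k \<in> \<G> n \<rightarrow>\<^sub>M borel"
  shows "U (Suc n) \<in> \<G> (Suc n) \<rightarrow>\<^sub>M borel"
    and "k \<in> {1..K} \<Longrightarrow> V (Suc n) k \<in> \<G> (Suc n) \<rightarrow>\<^sub>M borel"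
proof -
  have lift: "f \<in> \<G> n \<rightarrow>\<^sub>M borel \<Longrightarrow> f \<in> \<G> (Suc n) \<rightarrow>\<^sub>M borel" for f :: "'w \<Rightarrow> 'd rvec"
    by (rule measurable_from_subalg[OF noise_filtration_mono]) auto
  note [measurable] = Psi_measurable lift[OF U]
  have [measurable]: "\<zeta> (Suc n) \<in> \<G> (Suc n) \<rightarrow>\<^sub>M borel" "\<xi> (Suc n) \<in> \<G> (Suc n) \<rightarrow>\<^sub>M borel"
    by (rule measurable_noise_filtration; simp)+
  have "(\<lambda>\<omega>. \<Psi> (U n \<omega>) + \<zeta> (Suc n) \<omega>) \<in> \<G> (Suc n) \<rightarrow>\<^sub>M borel" by measurable
  then show U'[measurable]: "U (Suc n) \<in> \<G> (Suc n) \<rightarrow>\<^sub>M borel"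
    by (rule measurable_cong[THEN iffD1, rotated]) (simp add: space_noise_filtration signal)
  show "V (Suc n) k \<in> \<G> (Suc n) \<rightarrow>\<^sub>M borel" if k: "k \<in> {1..K}"
  proof -
    note [measurable] = measurable_noise_filtration(6)[OF _ k, of "Suc n" "Suc n", simplified]
      lam_measurable borel_measurable_matrix_vector_mult
    have "(\<lambda>\<omega>. analysis (obs_matrix h) (inflated_cov K (lam (Suc n) \<omega>)
          (\<lambda>j. \<Psi> (V n j \<omega>) + \<zeta>e (Suc n) j \<omega>)) (\<Psi> (V n k \<omega>) + \<zeta>e (Suc n) k \<omega>)
          (obs_matrix h *v U (Suc n) \<omega> + \<xi> (Suc n) \<omega> + \<xi>e (Suc n) k \<omega>)) \<in> \<G> (Suc n) \<rightarrow>\<^sub>M borel"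
    proof (rule borel_measurable_analysis[OF _ k])
      fix j assume j: "j \<in> {1..K}"
      note [measurable] = lift[OF V[OF j]] measurable_noise_filtration(5)[OF _ j, of "Suc n" "Suc n", simplified]
      show "(\<lambda>\<omega>. \<Psi> (V n j \<omega>) + \<zeta>e (Suc n) j \<omega>) \<in> \<G> (Suc n) \<rightarrow>\<^sub>M borel" by measurable
    qed measurable
    moreover have "analysis (obs_matrix h) (inflated_cov K (lam (Suc n) \<omega>)
          (\<lambda>j. \<Psi> (V n j \<omega>) + \<zeta>e (Suc n) j \<omega>)) (\<Psi> (V n k \<omega>) + \<zeta>e (Suc n) k \<omega>)
          (obs_matrix h *v U (Suc n) \<omega> + \<xi> (Suc n) \<omega> + \<xi>e (Suc n) k \<omega>) = V (Suc n) k \<omega>"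
      if "\<omega> \<in> space (\<G> (Suc n))" for \<omega>
    proof -
      have \<omega>: "\<omega> \<in> space M" using that by (simp add: space_noise_filtration)
      have "inflated_cov K (lam (Suc n) \<omega>) (\<lambda>j. Vf (Suc n) j \<omega>) =
          inflated_cov K (lam (Suc n) \<omega>) (\<lambda>j. \<Psi> (V n j \<omega>) + \<zeta>e (Suc n) j \<omega>)"
        unfolding inflated_cov_def using forecast[OF \<omega>] by (simp only: cong: ens_cov_cong)
      then show ?thesis
        using analysis_step[OF \<omega> k] forecast[OF \<omega> k] perturbed_observation[OF \<omega> k] observation[OF \<omega>]
        by simp
    qed
    ultimately show ?thesis by (rule measurable_cong[THEN iffD1, rotated])
  qed
qed

lemma measurable_state:
  "U n \<in> \<G> n \<rightarrow>\<^sub>M borel" "k \<in> {1..K} \<Longrightarrow> V n k \<in> \<G> n \<rightarrow>\<^sub>M borel"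
proof -
  have "U n \<in> \<G> n \<rightarrow>\<^sub>M borel \<and> (\<forall>k\<in>{1..K}. V n k \<in> \<G> n \<rightarrow>\<^sub>M borel)"
  proof (induction n)
    case 0 then show ?case by (blast intro: measurable_noise_filtration)
  next
    case (Suc n) then show ?case using measurable_state_step[of n] by blast
  qed
  then show "U n \<in> \<G> n \<rightarrow>\<^sub>M borel" "k \<in> {1..K} \<Longrightarrow> V n k \<in> \<G> n \<rightarrow>\<^sub>M borel" by blast+
qed

lemma state_borel_measurable:
  "U n \<in> M \<rightarrow>\<^sub>M borel" "k \<in> {1..K} \<Longrightarrow> V n k \<in> M \<rightarrow>\<^sub>M borel"
  by (rule measurable_from_subalg[OF subalgebra_noise_filtration measurable_state(1)],
      rule measurable_from_subalg[OF subalgebra_noise_filtration measurable_state(2)])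

lemma state_filtration_generators:
  "(\<Union>m\<in>{0..n}. events_of M (U m) \<union> (\<Union>k\<in>{1..K}. events_of M (V m k))) \<subseteq> Pow (space M)"
  by (auto simp: events_of_def)

text \<open>This inclusion is what the tower property needs in order to turn an estimate given the
  noises into one given the states.\<close>

lemma subalgebra_state_filtration: "subalgebra (\<G> n) (\<F> n)"
proof -
  have "(\<Union>m\<in>{0..n}. events_of M (U m) \<union> (\<Union>k\<in>{1..K}. events_of M (V m k))) \<subseteq> sets (\<G> n)"
    by (intro Un_least UN_least events_of_subset_sets space_noise_filtration
        measurable_from_subalg[OF noise_filtration_mono measurable_state(1)]
        measurable_from_subalg[OF noise_filtration_mono measurable_state(2)]; simp)
  then have "sigma_sets (space (\<G> n))
      (\<Union>m\<in>{0..n}. events_of M (U m) \<union> (\<Union>k\<in>{1..K}. events_of M (V m k))) \<subseteq> sets (\<G> n)"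
    by (rule sets.sigma_sets_subset)
  then show ?thesis
    unfolding subalgebra_def state_filtration_def space_noise_filtration
      space_measure_of[OF state_filtration_generators] sets_measure_of[OF state_filtration_generators]
    by simp
qed

lemma measurable_state_filtration:
  "U n \<in> \<F> n \<rightarrow>\<^sub>M borel" "k \<in> {1..K} \<Longrightarrow> V n k \<in> \<F> n \<rightarrow>\<^sub>M borel"
  unfolding state_filtration_def
  by (rule measurable_sigma_events_of[OF _ state_filtration_generators]; fastforce)+

lemma kernel_prob: "prob_space (\<kappa> u)" "sets (\<kappa> u) = sets borel"
  using measurable_space[OF kernel, of u] by (auto simp: space_prob_algebra)

lemma measure_kernel_UNIV: "measure (\<kappa> u) UNIV = 1" "measure (std_gaussian :: 'q rvec measure) UNIV = 1"
proof -
  show "measure (\<kappa> u) UNIV = 1"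
    using prob_space.prob_space[OF kernel_prob(1)[of u]] sets_eq_imp_space_eq[OF kernel_prob(2)[of u]] by simp
  have "(std_gaussian :: 'q rvec measure) \<in> space (prob_algebra borel)"
    by (rule std_gaussian_in_prob_algebra)
  then show "measure (std_gaussian :: 'q rvec measure) UNIV = 1"
    using prob_space.prob_space[of "std_gaussian :: 'q rvec measure"]
      sets_eq_imp_space_eq[of "std_gaussian :: 'q rvec measure" borel]
    by (simp add: space_prob_algebra)
qed

text \<open>The joint law is taken with \<open>UNIV\<close> in all slots but one; the other factors
  are then total masses of probability measures.\<close>

lemma noise_marginal_laws:
  "A \<in> sets borel \<Longrightarrow> AE \<omega> in M.
    real_cond_exp M (\<G> n) (indicator {\<omega> \<in> space M. \<zeta> (Suc n) \<omega> \<in> A}) \<omega> = measure (\<kappa> (U n \<omega>)) A"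
  "B \<in> sets borel \<Longrightarrow> AE \<omega> in M.
    real_cond_exp M (\<G> n) (indicator {\<omega> \<in> space M. \<xi> (Suc n) \<omega> \<in> B}) \<omega> = measure std_gaussian B"
  "A \<in> sets borel \<Longrightarrow> k \<in> {1..K} \<Longrightarrow> AE \<omega> in M.
    real_cond_exp M (\<G> n) (indicator {\<omega> \<in> space M. \<zeta>e (Suc n) k \<omega> \<in> A}) \<omega> = measure (\<kappa> (V n k \<omega>)) A"
  "B \<in> sets borel \<Longrightarrow> k \<in> {1..K} \<Longrightarrow> AE \<omega> in M.
    real_cond_exp M (\<G> n) (indicator {\<omega> \<in> space M. \<xi>e (Suc n) k \<omega> \<in> B}) \<omega> = measure std_gaussian B"
proof -
  note [simp] = measure_kernel_UNIV
  show "AE \<omega> in M. real_cond_exp M (\<G> n) (indicator {\<omega> \<in> space M. \<zeta> (Suc n) \<omega> \<in> A}) \<omega> =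
      measure (\<kappa> (U n \<omega>)) A" if "A \<in> sets borel"
    using noise_law[of A UNIV "\<lambda>_. UNIV" "\<lambda>_. UNIV" n] that by simp
  show "AE \<omega> in M. real_cond_exp M (\<G> n) (indicator {\<omega> \<in> space M. \<xi> (Suc n) \<omega> \<in> B}) \<omega> =
      measure std_gaussian B" if "B \<in> sets borel"
    using noise_law[of UNIV B "\<lambda>_. UNIV" "\<lambda>_. UNIV" n] that by simp
  show "AE \<omega> in M. real_cond_exp M (\<G> n) (indicator {\<omega> \<in> space M. \<zeta>e (Suc n) k \<omega> \<in> A}) \<omega> =
      measure (\<kappa> (V n k \<omega>)) A" if "A \<in> sets borel" "k \<in> {1..K}"
  proof -
    have "(\<forall>j\<in>{1..K}. \<zeta>e (Suc n) j \<omega> \<in> (if j = k then A else UNIV)) \<longleftrightarrow> \<zeta>e (Suc n) k \<omega> \<in> A" for \<omega>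
      using that(2) by auto
    moreover have "(\<Prod>j = 1..K. measure (\<kappa> (V n j \<omega>)) (if j = k then A else UNIV)) = measure (\<kappa> (V n k \<omega>)) A" for \<omega>
    proof -
      have "(\<Prod>j = 1..K. measure (\<kappa> (V n j \<omega>)) (if j = k then A else UNIV)) =
          (\<Prod>j = 1..K. if j = k then measure (\<kappa> (V n j \<omega>)) A else 1)"
        by (rule prod.cong) auto
      then show ?thesis using that(2) by (simp add: prod.delta)
    qed
    ultimately show ?thesis
      using noise_law[of UNIV UNIV "\<lambda>j. if j = k then A else UNIV" "\<lambda>_. UNIV" n] that(1) by simp
  qed
  show "AE \<omega> in M. real_cond_exp M (\<G> n) (indicator {\<omega> \<in> space M. \<xi>e (Suc n) k \<omega> \<in> B}) \<omega> =
      measure std_gaussian B" if "B \<in> sets borel" "k \<in> {1..K}"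
  proof -
    have "(\<forall>j\<in>{1..K}. \<xi>e (Suc n) j \<omega> \<in> (if j = k then B else UNIV)) \<longleftrightarrow> \<xi>e (Suc n) k \<omega> \<in> B" for \<omega>
      using that(2) by auto
    moreover have "(\<Prod>j = 1..K. measure std_gaussian (if j = k then B else UNIV)) = measure std_gaussian B"
    proof -
      have "(\<Prod>j = 1..K. measure std_gaussian (if j = k then B else UNIV)) =
          (\<Prod>j = 1..K. if j = k then measure std_gaussian B else 1)"
        by (rule prod.cong) auto
      then show ?thesis using that(2) by (simp add: prod.delta)
    qed
    ultimately show ?thesis
      using noise_law[of UNIV UNIV "\<lambda>_. UNIV" "\<lambda>j. if j = k then B else UNIV" n] that(1) by simp
  qed
qed

text \<open>\<open>X\<close> is either the signal or an ensemble member, as both are propagated by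
  \<open>\<Psi>\<close> with noise from the same kernel. The left-hand side is the quantity bounded
  by the energy principle, evaluated at \<open>X\<close>.\<close>

lemma nn_cond_exp_forecast_square:
  assumes X: "X \<in> \<G> n \<rightarrow>\<^sub>M borel" and Y: "Y \<in> M \<rightarrow>\<^sub>M borel"
    and law: "\<And>A. A \<in> sets borel \<Longrightarrow> AE \<omega> in M.
      real_cond_exp M (\<G> n) (indicator {\<omega> \<in> space M. Y \<omega> \<in> A}) \<omega> = measure (\<kappa> (X \<omega>)) A"
  shows "AE \<omega> in M. ennreal ((norm (\<Psi> (X \<omega>)))\<^sup>2 + trace (noise_cov \<kappa> (X \<omega>))) =
    nn_cond_exp M (\<G> n) (\<lambda>\<omega>. ennreal ((norm (\<Psi> (X \<omega>) + Y \<omega>))\<^sup>2)) \<omega>"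
proof -
  note [measurable] = Psi_measurable
  have "AE \<omega> in M. (\<integral>\<^sup>+y. (\<lambda>(x, y). ennreal ((norm (\<Psi> x + y))\<^sup>2)) (X \<omega>, y) \<partial>\<kappa> (X \<omega>)) =
      nn_cond_exp M (\<G> n) (\<lambda>\<omega>. (\<lambda>(x, y). ennreal ((norm (\<Psi> x + y))\<^sup>2)) (X \<omega>, Y \<omega>)) \<omega>"
    by (rule nn_cond_exp_disintegration[OF prob_space_axioms subalgebra_noise_filtration X Y kernel law],
        assumption, measurable)
  then show ?thesis
    by (simp add: nn_integral_norm_add_square kernel_prob kernel_second_moment kernel_mean trace_noise_cov)
qed

text \<open>A case of the disintegration with a constant kernel; \<open>U n\<close> is supplied as
  the variable known at time \<open>n\<close>.\<close>

lemma nn_cond_exp_gaussian_square: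
  assumes Y: "(Y :: 'w \<Rightarrow> 'q rvec) \<in> M \<rightarrow>\<^sub>M borel"
    and law: "\<And>A. A \<in> sets borel \<Longrightarrow> AE \<omega> in M.
      real_cond_exp M (\<G> n) (indicator {\<omega> \<in> space M. Y \<omega> \<in> A}) \<omega> = measure std_gaussian A"
  shows "AE \<omega> in M. ennreal (real CARD('q)) = nn_cond_exp M (\<G> n) (\<lambda>\<omega>. ennreal ((norm (Y \<omega>))\<^sup>2)) \<omega>"
proof -
  let ?f = "\<lambda>(x :: 'd rvec, y :: 'q rvec). ennreal ((norm y)\<^sup>2)"
  have "AE \<omega> in M. (\<integral>\<^sup>+y. ?f (U n \<omega>, y) \<partial>std_gaussian) = nn_cond_exp M (\<G> n) (\<lambda>\<omega>. ?f (U n \<omega>, Y \<omega>)) \<omega>"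
  proof (rule nn_cond_exp_disintegration[where f = ?f and X = "U n" and \<kappa> = "\<lambda>_. std_gaussian"
        and N = borel and L = borel, OF prob_space_axioms subalgebra_noise_filtration measurable_state(1) Y])
    show "(\<lambda>_. std_gaussian) \<in> borel \<rightarrow>\<^sub>M prob_algebra borel"
      by (rule measurable_const) (rule std_gaussian_in_prob_algebra)
    show "?f \<in> borel_measurable (borel \<Otimes>\<^sub>M borel)" by measurable
  qed (rule law)
  then show ?thesis
    by (simp add: nn_integral_std_gaussian_norm_square ennreal_of_nat_eq_real_of_nat)
qed

lemma nn_cond_exp_step_squares:
  "AE \<omega> in M. ennreal ((norm (\<Psi> (U n \<omega>)))\<^sup>2 + trace (noise_cov \<kappa> (U n \<omega>))) =
    nn_cond_exp M (\<G> n) (\<lambda>\<omega>. ennreal ((norm (\<Psi> (U n \<omega>) + \<zeta> (Suc n) \<omega>))\<^sup>2)) \<omega>"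
  "AE \<omega> in M. ennreal (real CARD('q)) = nn_cond_exp M (\<G> n) (\<lambda>\<omega>. ennreal ((norm (\<xi> (Suc n) \<omega>))\<^sup>2)) \<omega>"
  "k \<in> {1..K} \<Longrightarrow> AE \<omega> in M. ennreal ((norm (\<Psi> (V n k \<omega>)))\<^sup>2 + trace (noise_cov \<kappa> (V n k \<omega>))) =
    nn_cond_exp M (\<G> n) (\<lambda>\<omega>. ennreal ((norm (\<Psi> (V n k \<omega>) + \<zeta>e (Suc n) k \<omega>))\<^sup>2)) \<omega>"
  "k \<in> {1..K} \<Longrightarrow> AE \<omega> in M. ennreal (real CARD('q)) =
    nn_cond_exp M (\<G> n) (\<lambda>\<omega>. ennreal ((norm (\<xi>e (Suc n) k \<omega>))\<^sup>2)) \<omega>"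
     apply (rule nn_cond_exp_forecast_square[OF measurable_state(1) noise_measurable(1) noise_marginal_laws(1)], assumption)
    apply (rule nn_cond_exp_gaussian_square[OF noise_measurable(2) noise_marginal_laws(2)], assumption)
   apply (rule nn_cond_exp_forecast_square[OF measurable_state(2) noise_measurable(3) noise_marginal_laws(3)], assumption+)
  apply (rule nn_cond_exp_gaussian_square[OF noise_measurable(4) noise_marginal_laws(4)], assumption+)
  done

end

section \<open>Energy drift\<close>

lemma total_energy_nonneg: "0 \<le> total_energy K h \<beta> u v" if "\<And>i. h $ i > 0" "0 < \<beta>"
  unfolding total_energy_def using rho0_pos[OF that(1)] that(2)
  by (intro add_nonneg_nonneg mult_nonneg_nonneg sum_nonneg) simp_all

context enkf_ai
begin

lemma innovation_step_bounds:
  assumes "c > 0" "M1 > 0" "M2 > 0" and \<omega>: "\<omega> \<in> space M" and k: "k \<in> {1..K}"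
    and infl: "lam (Suc n) \<omega> \<ge> inflation_fun c M1 M2
      (Theta K (obs_matrix h) (\<lambda>k. Vf (Suc n) k \<omega>) (\<lambda>k. Ze (Suc n) k \<omega>))
      (Xi TYPE('q) K (\<lambda>k. Vf (Suc n) k \<omega>))"
  shows "norm (obs_matrix h *v V (Suc n) k \<omega> - Ze (Suc n) k \<omega>)
      \<le> sqrt (real K) * max M1 (inverse (rho0 h) * inverse c)"
    and "norm (unobs_part CARD('q) (V (Suc n) k \<omega>) - unobs_part CARD('q) (Vf (Suc n) k \<omega>))
      \<le> op_norm (obs_matrix h :: ('q, 'd) rmat) * sqrt (real K) * max (M1 * M2) (inverse (rho0 h) * inverse c)"
  using analysis_ensemble_bounds[OF dims h_pos K_ge_2 k assms(1-3) infl] analysis_step[OF \<omega> k]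
  by simp_all

text \<open>A pathwise bound: \<open>norm_analysis_le\<close> with \<open>e = \<beta> / 2\<close>,
  summed over the ensemble. The coefficient \<open>2 / \<beta>\<close> is \<open>1 / e\<close>.
  Signal and forecast end up with the same factor \<open>1 + \<beta> / 2\<close>, so one contraction
  argument serves both.\<close>

lemma total_energy_step_le:
  assumes "c > 0" "M1 > 0" "M2 > 0" "0 < \<beta>" and \<omega>: "\<omega> \<in> space M"
    and infl: "lam (Suc n) \<omega> \<ge> inflation_fun c M1 M2
      (Theta K (obs_matrix h) (\<lambda>k. Vf (Suc n) k \<omega>) (\<lambda>k. Ze (Suc n) k \<omega>))
      (Xi TYPE('q) K (\<lambda>k. Vf (Suc n) k \<omega>))"
  defines "Hn \<equiv> op_norm (obs_matrix h :: ('q, 'd) rmat)"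
  defines "A \<equiv> sqrt (real K) * max M1 (inverse (rho0 h) * inverse c)"
  defines "B \<equiv> Hn * sqrt (real K) * max (M1 * M2) (inverse (rho0 h) * inverse c)"
  shows "total_energy K h \<beta> (U (Suc n) \<omega>) (\<lambda>k. V (Suc n) k \<omega>)
    \<le> (1 + \<beta> / 2) * (4 * real K * inverse (rho0 h) * inverse \<beta> * Hn\<^sup>2) * (norm (U (Suc n) \<omega>))\<^sup>2
      + (\<Sum>k = 1..K. (1 + \<beta> / 2) * (norm (Vf (Suc n) k \<omega>))\<^sup>2)
      + (\<Sum>k = 1..K. 6 * inverse (rho0 h) * ((norm (\<xi> (Suc n) \<omega>))\<^sup>2 + (norm (\<xi>e (Suc n) k \<omega>))\<^sup>2))
      + real K * (6 * inverse (rho0 h) * A\<^sup>2 + (1 + 2 / \<beta>) * B\<^sup>2)"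
proof -
  let ?s = "inverse (rho0 h)" and ?u = "(norm (U (Suc n) \<omega>))\<^sup>2"
  have "(norm (V (Suc n) k \<omega>))\<^sup>2 \<le> 2 * ?s * Hn\<^sup>2 * ?u + (1 + \<beta> / 2) * (norm (Vf (Suc n) k \<omega>))\<^sup>2
      + 6 * ?s * ((norm (\<xi> (Suc n) \<omega>))\<^sup>2 + (norm (\<xi>e (Suc n) k \<omega>))\<^sup>2)
      + (6 * ?s * A\<^sup>2 + (1 + 2 / \<beta>) * B\<^sup>2)" (is "_ \<le> ?r k") if k: "k \<in> {1..K}" for k
  proof -
    have Ze: "Ze (Suc n) k \<omega> = obs_matrix h *v U (Suc n) \<omega> + \<xi> (Suc n) \<omega> + \<xi>e (Suc n) k \<omega>"
      using perturbed_observation[OF \<omega> k] observation[OF \<omega>] by simp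
    have "(norm (V (Suc n) k \<omega>))\<^sup>2 \<le> ?s * (2 * Hn\<^sup>2 * ?u
        + 6 * (A\<^sup>2 + (norm (\<xi> (Suc n) \<omega>))\<^sup>2 + (norm (\<xi>e (Suc n) k \<omega>))\<^sup>2))
        + (1 + \<beta> / 2) * (norm (Vf (Suc n) k \<omega>))\<^sup>2 + (1 + 1 / (\<beta> / 2)) * B\<^sup>2"
      unfolding Hn_def
      by (rule norm_analysis_le[OF dims h_pos])
         (use innovation_step_bounds[OF assms(1-3) \<omega> k infl, unfolded Ze] assms(4)
          in \<open>simp_all only: A_def B_def Hn_def half_gt_zero\<close>)
    also have "\<dots> = ?r k" by (simp add: algebra_simps)
    finally show ?thesis .
  qed
  then have "(\<Sum>k = 1..K. (norm (V (Suc n) k \<omega>))\<^sup>2) \<le> (\<Sum>k = 1..K. ?r k)" by (rule sum_mono)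
  also have "\<dots> = real K * (2 * ?s * Hn\<^sup>2 * ?u) + (\<Sum>k = 1..K. (1 + \<beta> / 2) * (norm (Vf (Suc n) k \<omega>))\<^sup>2)
      + (\<Sum>k = 1..K. 6 * ?s * ((norm (\<xi> (Suc n) \<omega>))\<^sup>2 + (norm (\<xi>e (Suc n) k \<omega>))\<^sup>2))
      + real K * (6 * ?s * A\<^sup>2 + (1 + 2 / \<beta>) * B\<^sup>2)"
    by (simp add: sum.distrib distrib_left)
  finally have sum_le: "(\<Sum>k = 1..K. (norm (V (Suc n) k \<omega>))\<^sup>2) \<le> \<dots>" .
  \<comment> \<open>The observed parts of the \<open>K\<close> members together cost exactly the
    fraction \<open>\<beta> / 2\<close> of the weighted signal term; the weight in the energy is
    chosen for this identity.\<close>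
  have "4 * real K * ?s * inverse \<beta> * Hn\<^sup>2 * ?u + real K * (2 * ?s * Hn\<^sup>2 * ?u)
      = (1 + \<beta> / 2) * (4 * real K * ?s * inverse \<beta> * Hn\<^sup>2) * ?u"
    using \<open>0 < \<beta>\<close> rho0_pos[OF h_pos] by (simp add: field_simps)
  with sum_le show ?thesis unfolding total_energy_def Hn_def[symmetric] by linarith
qed

text \<open>\<open>D\<close> is built from the constants of model and filter before \<open>n\<close>
  is fixed, hence uniform in time, which the bound on the supremum of the expectations relies
  on.\<close>

lemma nn_cond_exp_total_energy_le:
  assumes c: "c > 0" "M1 > 0" "M2 > 0" and energy: "energy_principle \<Psi> \<kappa> \<beta> Kh"
    and infl: "\<And>n. AE \<omega> in M. lam (Suc n) \<omega> \<ge> inflation_fun c M1 M2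
      (Theta K (obs_matrix h) (\<lambda>k. Vf (Suc n) k \<omega>) (\<lambda>k. Ze (Suc n) k \<omega>))
      (Xi TYPE('q) K (\<lambda>k. Vf (Suc n) k \<omega>))"
  shows "\<exists>D>0. \<forall>n. AE \<omega> in M.
    nn_cond_exp M (\<F> n) (\<lambda>\<omega>. ennreal (total_energy K h \<beta> (U (Suc n) \<omega>) (\<lambda>k. V (Suc n) k \<omega>))) \<omega>
      \<le> ennreal ((1 - \<beta> / 2) * total_energy K h \<beta> (U n \<omega>) (\<lambda>k. V n k \<omega>) + D)"
proof -
  have \<beta>: "0 < \<beta>" "\<beta> < 1" "0 < Kh"
    and energy_le: "\<And>u. (norm (\<Psi> u))\<^sup>2 + trace (noise_cov \<kappa> u) \<le> (1 - \<beta>) * (norm u)\<^sup>2 + Kh"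
    using energy by (auto simp: energy_principle_def)
  define s where "s = inverse (rho0 h)"
  define Hn where "Hn = op_norm (obs_matrix h :: ('q, 'd) rmat)"
  define A where "A = sqrt (real K) * max M1 (inverse (rho0 h) * inverse c)"
  define B where "B = Hn * sqrt (real K) * max (M1 * M2) (inverse (rho0 h) * inverse c)"
  define a where "a = 4 * real K * inverse (rho0 h) * inverse \<beta> * Hn\<^sup>2"
  define C where "C = real K * (6 * s * A\<^sup>2 + (1 + 2 / \<beta>) * B\<^sup>2)"
  define q where "q = real CARD('q)"
  \<comment> \<open>\<open>Kh\<close> enters once through the signal, with weight \<open>a\<close>,
    and once per member. Each member carries two Gaussian terms with factor 6 and second moment
    \<open>q\<close>, hence 12. \<open>C\<close> collects the deterministic displacements, and the
    summand 1 gives positivity, the rest being nonnegative.\<close>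
  define D where "D = (1 + \<beta> / 2) * (a + real K) * Kh + 12 * s * real K * q + C + 1"
  have s: "0 < s" unfolding s_def using rho0_pos[OF h_pos] by simp
  have a: "0 \<le> a" unfolding a_def s_def[symmetric] using s \<beta> by simp
  have C: "0 \<le> C" unfolding C_def using s \<beta> by (intro mult_nonneg_nonneg add_nonneg_nonneg) auto
  have D: "0 < D" unfolding D_def q_def using s a C \<beta> by (intro add_nonneg_pos add_nonneg_nonneg) auto
  define E where "E = (\<lambda>n \<omega>. total_energy K h \<beta> (U n \<omega>) (\<lambda>k. V n k \<omega>))"
  define tr where "tr = (\<lambda>u. (norm (\<Psi> u))\<^sup>2 + trace (noise_cov \<kappa> u))"
  have tr_nonneg: "0 \<le> tr u" for u
    by (simp add: tr_def trace_noise_cov kernel_prob kernel_second_moment)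
  have E_nonneg: "0 \<le> E n \<omega>" for n \<omega>
    unfolding E_def using h_pos \<beta>(1) by (rule total_energy_nonneg)
  have "AE \<omega> in M. nn_cond_exp M (\<F> n) (\<lambda>\<omega>. ennreal (E (Suc n) \<omega>)) \<omega> \<le> ennreal ((1 - \<beta> / 2) * E n \<omega> + D)" for n
  proof -
    interpret G: finite_measure_subalgebra M "\<G> n"
      by unfold_locales (rule subalgebra_noise_filtration)
    have subF: "subalgebra M (\<F> n)"
      using subalgebra_noise_filtration[of n] subalgebra_state_filtration[of n] by (auto simp: subalgebra_def)
    interpret F: finite_measure_subalgebra M "\<F> n" by unfold_locales (rule subF)
    note [measurable] = Psi_measurable state_borel_measurable noise_measurable
    have [measurable]: "E m \<in> borel_measurable M" for m
      unfolding E_def total_energy_def by measurable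
    have [measurable]: "E n \<in> borel_measurable (\<F> n)"
    proof -
      note [measurable] = measurable_state_filtration
      show ?thesis unfolding E_def total_energy_def by measurable
    qed
    \<comment> \<open>\<open>g\<close> dominates the next energy. Each of its squares contains a
      single noise, so its conditional expectation given \<open>\<G> n\<close> is found term by
      term; the result \<open>f\<close> depends only on the state at time \<open>n\<close>.\<close>
    define g where "g = (\<lambda>\<omega>. ennreal ((1 + \<beta> / 2) * a) * ennreal ((norm (\<Psi> (U n \<omega>) + \<zeta> (Suc n) \<omega>))\<^sup>2)
      + (\<Sum>k = 1..K. ennreal (1 + \<beta> / 2) * ennreal ((norm (\<Psi> (V n k \<omega>) + \<zeta>e (Suc n) k \<omega>))\<^sup>2))
      + (\<Sum>k = 1..K. ennreal (6 * s) * (ennreal ((norm (\<xi> (Suc n) \<omega>))\<^sup>2) + ennreal ((norm (\<xi>e (Suc n) k \<omega>))\<^sup>2)))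
      + ennreal C)"
    define f where "f = (\<lambda>\<omega>. ennreal ((1 + \<beta> / 2) * a) * ennreal (tr (U n \<omega>))
      + (\<Sum>k = 1..K. ennreal (1 + \<beta> / 2) * ennreal (tr (V n k \<omega>)))
      + (\<Sum>k = 1..K. ennreal (6 * s) * (ennreal q + ennreal q)) + ennreal C)"
    have g_meas[measurable]: "g \<in> borel_measurable M" unfolding g_def by measurable
    have f_g: "AE \<omega> in M. f \<omega> = nn_cond_exp M (\<G> n) g \<omega>"
      unfolding f_def g_def
    proof (rule G.nn_cond_exp_eq_add)
      show "AE \<omega> in M. ennreal C = nn_cond_exp M (\<G> n) (\<lambda>_. ennreal C) \<omega>"
        by (rule G.nn_cond_exp_F_meas) measurable
      show "AE \<omega> in M. ennreal ((1 + \<beta> / 2) * a) * ennreal (tr (U n \<omega>))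
          + (\<Sum>k = 1..K. ennreal (1 + \<beta> / 2) * ennreal (tr (V n k \<omega>)))
          + (\<Sum>k = 1..K. ennreal (6 * s) * (ennreal q + ennreal q)) =
        nn_cond_exp M (\<G> n) (\<lambda>\<omega>. ennreal ((1 + \<beta> / 2) * a) * ennreal ((norm (\<Psi> (U n \<omega>) + \<zeta> (Suc n) \<omega>))\<^sup>2)
          + (\<Sum>k = 1..K. ennreal (1 + \<beta> / 2) * ennreal ((norm (\<Psi> (V n k \<omega>) + \<zeta>e (Suc n) k \<omega>))\<^sup>2))
          + (\<Sum>k = 1..K. ennreal (6 * s) * (ennreal ((norm (\<xi> (Suc n) \<omega>))\<^sup>2) + ennreal ((norm (\<xi>e (Suc n) k \<omega>))\<^sup>2)))) \<omega>"
        unfolding tr_def q_def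
      proof (rule G.nn_cond_exp_eq_add[OF _ _ G.nn_cond_exp_eq_add])
        show "AE \<omega> in M. ennreal ((1 + \<beta> / 2) * a) * ennreal ((norm (\<Psi> (U n \<omega>)))\<^sup>2 + trace (noise_cov \<kappa> (U n \<omega>))) =
            nn_cond_exp M (\<G> n) (\<lambda>\<omega>. ennreal ((1 + \<beta> / 2) * a) * ennreal ((norm (\<Psi> (U n \<omega>) + \<zeta> (Suc n) \<omega>))\<^sup>2)) \<omega>"
          by (rule G.nn_cond_exp_eq_cmult[OF _ nn_cond_exp_step_squares(1)]) measurable
        show "AE \<omega> in M. (\<Sum>k = 1..K. ennreal (1 + \<beta> / 2) *
              ennreal ((norm (\<Psi> (V n k \<omega>)))\<^sup>2 + trace (noise_cov \<kappa> (V n k \<omega>)))) =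
            nn_cond_exp M (\<G> n) (\<lambda>\<omega>. \<Sum>k = 1..K. ennreal (1 + \<beta> / 2) *
              ennreal ((norm (\<Psi> (V n k \<omega>) + \<zeta>e (Suc n) k \<omega>))\<^sup>2)) \<omega>"
        proof (rule G.nn_cond_exp_eq_sum)
          fix k assume k: "k \<in> {1..K}"
          show "AE \<omega> in M. ennreal (1 + \<beta> / 2) *
              ennreal ((norm (\<Psi> (V n k \<omega>)))\<^sup>2 + trace (noise_cov \<kappa> (V n k \<omega>))) =
            nn_cond_exp M (\<G> n) (\<lambda>\<omega>. ennreal (1 + \<beta> / 2) *
              ennreal ((norm (\<Psi> (V n k \<omega>) + \<zeta>e (Suc n) k \<omega>))\<^sup>2)) \<omega>"
            using k by (intro G.nn_cond_exp_eq_cmult[OF _ nn_cond_exp_step_squares(3)[OF k]]) measurable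
        qed measurable
        show "AE \<omega> in M. (\<Sum>k = 1..K. ennreal (6 * s) * (ennreal (real CARD('q)) + ennreal (real CARD('q)))) =
            nn_cond_exp M (\<G> n) (\<lambda>\<omega>. \<Sum>k = 1..K. ennreal (6 * s) *
              (ennreal ((norm (\<xi> (Suc n) \<omega>))\<^sup>2) + ennreal ((norm (\<xi>e (Suc n) k \<omega>))\<^sup>2))) \<omega>"
        proof (rule G.nn_cond_exp_eq_sum)
          fix k assume k: "k \<in> {1..K}"
          show "AE \<omega> in M. ennreal (6 * s) * (ennreal (real CARD('q)) + ennreal (real CARD('q))) =
            nn_cond_exp M (\<G> n) (\<lambda>\<omega>. ennreal (6 * s) *
              (ennreal ((norm (\<xi> (Suc n) \<omega>))\<^sup>2) + ennreal ((norm (\<xi>e (Suc n) k \<omega>))\<^sup>2))) \<omega>"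
            using k by (intro G.nn_cond_exp_eq_cmult[OF _ G.nn_cond_exp_eq_add[OF _ _
                  nn_cond_exp_step_squares(2) nn_cond_exp_step_squares(4)[OF k]]]) measurable
        qed measurable
      qed measurable
    qed measurable
    have E_g: "AE \<omega> in M. ennreal (E (Suc n) \<omega>) \<le> g \<omega>"
      using infl[of n] AE_space
    proof eventually_elim
      fix \<omega> assume infl: "lam (Suc n) \<omega> \<ge> inflation_fun c M1 M2
          (Theta K (obs_matrix h) (\<lambda>k. Vf (Suc n) k \<omega>) (\<lambda>k. Ze (Suc n) k \<omega>))
          (Xi TYPE('q) K (\<lambda>k. Vf (Suc n) k \<omega>))" and \<omega>: "\<omega> \<in> space M"
      have "E (Suc n) \<omega> \<le> (1 + \<beta> / 2) * a * (norm (\<Psi> (U n \<omega>) + \<zeta> (Suc n) \<omega>))\<^sup>2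
        + (\<Sum>k = 1..K. (1 + \<beta> / 2) * (norm (\<Psi> (V n k \<omega>) + \<zeta>e (Suc n) k \<omega>))\<^sup>2)
        + (\<Sum>k = 1..K. 6 * s * ((norm (\<xi> (Suc n) \<omega>))\<^sup>2 + (norm (\<xi>e (Suc n) k \<omega>))\<^sup>2)) + C"
        using total_energy_step_le[OF c \<beta>(1) \<omega> infl] forecast[OF \<omega>]
        unfolding E_def a_def C_def A_def B_def Hn_def s_def signal[OF \<omega>, symmetric]
        by (simp cong: sum.cong_simp)
      then show "ennreal (E (Suc n) \<omega>) \<le> g \<omega>"
        unfolding g_def using a s C \<beta>
        by (simp add: sum_nonneg sum_ennreal flip: ennreal_plus ennreal_mult)
    qed
    have f_le: "f \<omega> \<le> ennreal ((1 - \<beta> / 2) * E n \<omega> + D)" for \<omega>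
    proof -
      have contr: "(1 + \<beta> / 2) * tr u \<le> (1 - \<beta> / 2) * (norm u)\<^sup>2 + (1 + \<beta> / 2) * Kh" for u
      proof -
        have "(1 + \<beta> / 2) * tr u \<le> (1 + \<beta> / 2) * ((1 - \<beta>) * (norm u)\<^sup>2 + Kh)"
          unfolding tr_def using \<beta> by (intro mult_left_mono energy_le) auto
        \<comment> \<open>The loss \<open>1 + \<beta> / 2\<close> uses up half of the contraction
          \<open>1 - \<beta>\<close>; the leftover quadratic term has a favourable sign.\<close>
        also have "\<dots> = (1 - \<beta> / 2 - \<beta>\<^sup>2 / 2) * (norm u)\<^sup>2 + (1 + \<beta> / 2) * Kh"
          by (simp add: power2_eq_square algebra_simps)
        also have "\<dots> \<le> (1 - \<beta> / 2) * (norm u)\<^sup>2 + (1 + \<beta> / 2) * Kh"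
          by (intro add_right_mono mult_right_mono) auto
        finally show ?thesis .
      qed
      have "a * ((1 + \<beta> / 2) * tr (U n \<omega>)) \<le> a * ((1 - \<beta> / 2) * (norm (U n \<omega>))\<^sup>2 + (1 + \<beta> / 2) * Kh)"
        using a by (intro mult_left_mono contr)
      moreover define SV where "SV = (\<Sum>k = 1..K. (norm (V n k \<omega>))\<^sup>2)"
      moreover define ST where "ST = (\<Sum>k = 1..K. (1 + \<beta> / 2) * tr (V n k \<omega>))"
      moreover have "ST \<le> (1 - \<beta> / 2) * SV + real K * ((1 + \<beta> / 2) * Kh)"
      proof -
        have "ST \<le> (\<Sum>k = 1..K. (1 - \<beta> / 2) * (norm (V n k \<omega>))\<^sup>2 + (1 + \<beta> / 2) * Kh)"
          unfolding ST_def by (intro sum_mono contr)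
        also have "\<dots> = (1 - \<beta> / 2) * SV + real K * ((1 + \<beta> / 2) * Kh)"
          by (simp add: SV_def sum.distrib sum_distrib_left)
        finally show ?thesis .
      qed
      moreover have "E n \<omega> = a * (norm (U n \<omega>))\<^sup>2 + SV"
        by (simp add: E_def total_energy_def SV_def a_def Hn_def)
      ultimately have "(1 + \<beta> / 2) * a * tr (U n \<omega>) + (\<Sum>k = 1..K. (1 + \<beta> / 2) * tr (V n k \<omega>))
          + (\<Sum>k = 1..K. 6 * s * (q + q)) + C \<le> (1 - \<beta> / 2) * E n \<omega> + D"
        unfolding D_def ST_def[symmetric] by (simp add: algebra_simps add_divide_distrib)
      then show ?thesis
        unfolding f_def q_def using a s C \<beta> tr_nonneg
        by (simp add: sum_nonneg sum_ennreal ennreal_of_nat_eq_real_of_nat ennreal_leI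
            flip: ennreal_plus ennreal_mult)
    qed
    let ?b = "\<lambda>\<omega>. ennreal ((1 - \<beta> / 2) * E n \<omega> + D)"
    \<comment> \<open>Tower property: the bound obtained under \<open>\<G> n\<close> is already
      measurable with respect to \<open>\<F> n\<close>, so conditioning down leaves it
      unchanged.\<close>
    have "AE \<omega> in M. nn_cond_exp M (\<F> n) (\<lambda>\<omega>. ennreal (E (Suc n) \<omega>)) \<omega> \<le> nn_cond_exp M (\<F> n) g \<omega>"
      by (rule F.nn_cond_exp_mono[OF E_g]) measurable
    moreover have "AE \<omega> in M. nn_cond_exp M (\<F> n) g \<omega> = nn_cond_exp M (\<F> n) (nn_cond_exp M (\<G> n) g) \<omega>"
      by (rule F.nn_cond_exp_nested_subalg[OF subalgebra_noise_filtration subalgebra_state_filtration g_meas])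
    moreover have "AE \<omega> in M. nn_cond_exp M (\<F> n) (nn_cond_exp M (\<G> n) g) \<omega> \<le> nn_cond_exp M (\<F> n) ?b \<omega>"
    proof (rule F.nn_cond_exp_mono)
      show "AE \<omega> in M. nn_cond_exp M (\<G> n) g \<omega> \<le> ?b \<omega>"
        using f_g by eventually_elim (use f_le in metis)
    qed measurable
    moreover have "AE \<omega> in M. ?b \<omega> = nn_cond_exp M (\<F> n) ?b \<omega>"
      by (rule F.nn_cond_exp_F_meas) measurable
    ultimately show ?thesis by eventually_elim simp
  qed
  then show ?thesis using D unfolding E_def by blast
qed

end

text \<open>Expectations obey \<open>e (n+1) \<le> (1 - \<gamma>) * e n + D\<close>. The map on the
  right has the fixed point \<open>D / \<gamma>\<close>, so the level
  \<open>e0 + D / \<gamma>\<close> is never exceeded.\<close>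

lemma (in prob_space) SUP_nn_integral_finite_of_drift:
  fixes E :: "nat \<Rightarrow> 'a \<Rightarrow> real"
  assumes sub: "\<And>n. subalgebra M (F n)" and meas: "\<And>n. E n \<in> borel_measurable M"
    and nonneg: "\<And>n \<omega>. 0 \<le> E n \<omega>" and \<gamma>: "0 < \<gamma>" "\<gamma> \<le> 1" and "0 \<le> D"
    and drift: "\<And>n. AE \<omega> in M. nn_cond_exp M (F n) (\<lambda>\<omega>. ennreal (E (Suc n) \<omega>)) \<omega>
      \<le> ennreal ((1 - \<gamma>) * E n \<omega> + D)"
    and init: "(\<integral>\<^sup>+\<omega>. ennreal (E 0 \<omega>) \<partial>M) < \<infinity>"
  shows "(SUP n. \<integral>\<^sup>+\<omega>. ennreal (E n \<omega>) \<partial>M) < \<infinity>"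
proof -
  note [measurable] = meas
  obtain e0 where e0: "0 \<le> e0" "(\<integral>\<^sup>+\<omega>. ennreal (E 0 \<omega>) \<partial>M) = ennreal e0"
    using init by (cases "\<integral>\<^sup>+\<omega>. ennreal (E 0 \<omega>) \<partial>M") auto
  have step: "(\<integral>\<^sup>+\<omega>. ennreal (E (Suc n) \<omega>) \<partial>M) \<le> ennreal (1 - \<gamma>) * (\<integral>\<^sup>+\<omega>. ennreal (E n \<omega>) \<partial>M) + ennreal D" for n
  proof -
    interpret F: finite_measure_subalgebra M "F n" by unfold_locales (rule sub)
    have "(\<integral>\<^sup>+\<omega>. ennreal (E (Suc n) \<omega>) \<partial>M) = (\<integral>\<^sup>+\<omega>. nn_cond_exp M (F n) (\<lambda>\<omega>. ennreal (E (Suc n) \<omega>)) \<omega> \<partial>M)"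
      using F.nn_cond_exp_intg[of "\<lambda>_. 1" "\<lambda>\<omega>. ennreal (E (Suc n) \<omega>)"] by simp
    also have "\<dots> \<le> (\<integral>\<^sup>+\<omega>. ennreal (1 - \<gamma>) * ennreal (E n \<omega>) + ennreal D \<partial>M)"
      using drift[of n] \<gamma> nonneg \<open>0 \<le> D\<close>
      by (intro nn_integral_mono_AE) (simp flip: ennreal_plus ennreal_mult)
    also have "\<dots> = ennreal (1 - \<gamma>) * (\<integral>\<^sup>+\<omega>. ennreal (E n \<omega>) \<partial>M) + ennreal D"
      by (simp add: nn_integral_add nn_integral_cmult emeasure_space_1)
    finally show ?thesis .
  qed
  have "(\<integral>\<^sup>+\<omega>. ennreal (E n \<omega>) \<partial>M) \<le> ennreal (e0 + D / \<gamma>)" for n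
  proof (induction n)
    case 0 then show ?case using e0 \<gamma> \<open>0 \<le> D\<close> by (simp add: ennreal_leI)
  next
    case (Suc n)
    have "(\<integral>\<^sup>+\<omega>. ennreal (E (Suc n) \<omega>) \<partial>M) \<le> ennreal (1 - \<gamma>) * ennreal (e0 + D / \<gamma>) + ennreal D"
      using step[of n] Suc by (meson add_right_mono mult_left_mono order_trans zero_le)
    also have "\<dots> = ennreal ((1 - \<gamma>) * (e0 + D / \<gamma>) + D)"
      using \<gamma> e0 \<open>0 \<le> D\<close> by (simp flip: ennreal_plus ennreal_mult)
    also have "\<dots> \<le> ennreal (e0 + D / \<gamma>)"
      using \<gamma> e0 by (intro ennreal_leI) (simp add: field_simps)
    finally show ?case .
  qed
  then have "(SUP n. \<integral>\<^sup>+\<omega>. ennreal (E n \<omega>) \<partial>M) \<le> ennreal (e0 + D / \<gamma>)" by (rule SUP_least)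
  then show ?thesis by (simp add: le_less_trans)
qed

theorem theorem4p3:
  fixes M :: "'w measure"
    and \<Psi> :: "('d :: {finite, linorder}) rvec \<Rightarrow> 'd rvec"
    and \<kappa> :: "'d rvec \<Rightarrow> ('d rvec) measure"
    and h :: "('q :: {finite, linorder}) rvec"
    and K :: nat
    and c_phi M1 M2 :: real
    and U \<zeta> :: "nat \<Rightarrow> 'w \<Rightarrow> 'd rvec"
    and Z \<xi> :: "nat \<Rightarrow> 'w \<Rightarrow> 'q rvec"
    and Vf \<zeta>e V :: "nat \<Rightarrow> nat \<Rightarrow> 'w \<Rightarrow> 'd rvec"
    and Ze \<xi>e :: "nat \<Rightarrow> nat \<Rightarrow> 'w \<Rightarrow> 'q rvec"
    and lam :: "nat \<Rightarrow> 'w \<Rightarrow> real"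
  assumes process: "enkf_ai M \<Psi> \<kappa> h K U \<zeta> Z \<xi> Vf \<zeta>e Ze \<xi>e lam V"
    and constants: "c_phi > 0" "M1 > 0" "M2 > 0"
    and inflation: "\<And>n. n \<ge> 1 \<Longrightarrow> AE \<omega> in M.
      lam n \<omega> \<ge> inflation_fun c_phi M1 M2
        (Theta K (obs_matrix h) (\<lambda>k. Vf n k \<omega>) (\<lambda>k. Ze n k \<omega>))
        (Xi TYPE('q) K (\<lambda>k. Vf n k \<omega>))"
  shows "(\<forall>n\<ge>1. \<forall>k\<in>{1..K}. AE \<omega> in M.
            norm (obs_matrix h *v V n k \<omega> - Ze n k \<omega>)
              \<le> sqrt (real K) * max M1 (inverse (rho0 h) * inverse c_phi))
       \<and> (\<forall>\<beta> Kh. energy_principle \<Psi> \<kappa> \<beta> Kh \<longrightarrow>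
            (\<exists>D>0. \<forall>n\<ge>1. AE \<omega> in M.
               nn_cond_exp M (state_filtration M K U V (n - 1))
                 (\<lambda>\<omega>. ennreal (total_energy K h \<beta> (U n \<omega>) (\<lambda>k. V n k \<omega>))) \<omega>
               \<le> ennreal ((1 - \<beta> / 2) *
                    total_energy K h \<beta> (U (n - 1) \<omega>) (\<lambda>k. V (n - 1) k \<omega>) + D))
            \<and> ((\<integral>\<^sup>+ \<omega>. ennreal (total_energy K h \<beta> (U 0 \<omega>) (\<lambda>k. V 0 k \<omega>)) \<partial>M) < \<infinity> \<longrightarrow>
                (SUP n. \<integral>\<^sup>+ \<omega>. ennreal (total_energy K h \<beta> (U n \<omega>) (\<lambda>k. V n k \<omega>)) \<partial>M) < \<infinity>))"
proof -
  interpret enkf_ai M \<Psi> \<kappa> h K U \<zeta> Z \<xi> Vf \<zeta>e Ze \<xi>e lam V by (rule process)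
  have infl: "AE \<omega> in M. lam (Suc n) \<omega> \<ge> inflation_fun c_phi M1 M2
      (Theta K (obs_matrix h) (\<lambda>k. Vf (Suc n) k \<omega>) (\<lambda>k. Ze (Suc n) k \<omega>))
      (Xi TYPE('q) K (\<lambda>k. Vf (Suc n) k \<omega>))" for n
    using inflation[of "Suc n"] by simp
  have all_Suc: "(\<forall>n\<ge>1. P n) \<longleftrightarrow> (\<forall>n. P (Suc n))" for P
    by (metis One_nat_def Suc_le_D le_add1 plus_1_eq_Suc)
  show ?thesis
    unfolding all_Suc
  proof (intro conjI allI ballI impI)
    show "AE \<omega> in M. norm (obs_matrix h *v V (Suc n) k \<omega> - Ze (Suc n) k \<omega>)
        \<le> sqrt (real K) * max M1 (inverse (rho0 h) * inverse c_phi)" if "k \<in> {1..K}" for n k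
      using infl[of n] AE_space
      by eventually_elim (rule innovation_step_bounds(1)[OF constants _ that])
  next
    fix \<beta> Kh assume energy: "energy_principle \<Psi> \<kappa> \<beta> Kh"
    then show "\<exists>D>0. \<forall>n. AE \<omega> in M.
        nn_cond_exp M (state_filtration M K U V (Suc n - 1))
          (\<lambda>\<omega>. ennreal (total_energy K h \<beta> (U (Suc n) \<omega>) (\<lambda>k. V (Suc n) k \<omega>))) \<omega>
        \<le> ennreal ((1 - \<beta> / 2) * total_energy K h \<beta> (U (Suc n - 1) \<omega>) (\<lambda>k. V (Suc n - 1) k \<omega>) + D)"
      using nn_cond_exp_total_energy_le[OF constants energy infl] by simp
  next
    fix \<beta> Kh assume energy: "energy_principle \<Psi> \<kappa> \<beta> Kh"
      and init: "(\<integral>\<^sup>+ \<omega>. ennreal (total_energy K h \<beta> (U 0 \<omega>) (\<lambda>k. V 0 k \<omega>)) \<partial>M) < \<infinity>"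
    have \<beta>: "0 < \<beta>" "\<beta> < 1" using energy by (auto simp: energy_principle_def)
    obtain D where D: "D > 0" "\<And>n. AE \<omega> in M.
        nn_cond_exp M (state_filtration M K U V n)
          (\<lambda>\<omega>. ennreal (total_energy K h \<beta> (U (Suc n) \<omega>) (\<lambda>k. V (Suc n) k \<omega>))) \<omega>
        \<le> ennreal ((1 - \<beta> / 2) * total_energy K h \<beta> (U n \<omega>) (\<lambda>k. V n k \<omega>) + D)"
      using nn_cond_exp_total_energy_le[OF constants energy infl] by blast
    show "(SUP n. \<integral>\<^sup>+ \<omega>. ennreal (total_energy K h \<beta> (U n \<omega>) (\<lambda>k. V n k \<omega>)) \<partial>M) < \<infinity>"
    \<comment> \<open>The rate is \<open>\<gamma> = \<beta> / 2\<close>, read off from the drift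
      inequality.\<close>
    proof (rule SUP_nn_integral_finite_of_drift[where F = "state_filtration M K U V", OF _ _ _ _ _ _ D(2) init])
      show "subalgebra M (state_filtration M K U V n)" for n
        using subalgebra_noise_filtration[of n] subalgebra_state_filtration[of n]
        by (auto simp: subalgebra_def)
      note [measurable] = state_borel_measurable
      show "(\<lambda>\<omega>. total_energy K h \<beta> (U n \<omega>) (\<lambda>k. V n k \<omega>)) \<in> borel_measurable M" for n
        unfolding total_energy_def by measurable
      show "0 \<le> total_energy K h \<beta> (U n \<omega>) (\<lambda>k. V n k \<omega>)" for n \<omega>
        using h_pos \<beta>(1) by (rule total_energy_nonneg)
    qed (use \<beta> D(1) in auto)
  qed
qed

end
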